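(* Let $\Sigma\in\mathcal{G}_n$ and let $Q_0$ be the unique regular rational orthogonal matrix with $Q_0^{\rm T}S(\Sigma)Q_0=S(\Sigma^{\rm T})$. If $Q_0$ is not factorable, then $\Sigma$ is weakly determined by the generalized skew-spectrum (WDGSS).
   Context: An oriented graph on vertices $v_1,\dots,v_n$ is a simple graph with each edge directed; its skew-adjacency matrix $S(\Sigma)=(s_{ij})$ has $s_{ij}=1$ if $(v_i,v_j)$ is an arc, $-1$ if $(v_j,v_i)$ is an arc, $0$ otherwise. The converse $\Sigma^{\rm T}$ reverses every arc, so $S(\Sigma^{\rm T})=-S(\Sigma)$. Two oriented graphs are isomorphic if their skew-adjacency matrices are conjugate by a permutation matrix; they are generalized cospectral if their skew-adjacency matrices $S$ have the same spectrum and the matrices $J-I-S$ have the same spectrum. $\Sigma$ is WDGSS if every oriented graph generalized cospectral with $\Sigma$ is isomorphic to $\Sigma$ or to $\Sigma^{\rm T}$. With $e$ the all-one vector, $W(\Sigma)=[e,Se,\dots,S^{n-1}e]$, $S=S(\Sigma)$. $\mathcal{G}_n$ is the set of $n$-vertex oriented graphs with $2^{-\lfloor n/2\rfloor}\det W(\Sigma)$ an odd square-free integer. A rational orthogonal matrix $Q$ is regular if $Qe=e$; its level is the least positive integer $k$ with $kQ$ integral. A regular rational orthogonal matrix of level $\ell$ is factorable if it can be written as the product of two regular rational orthogonal matrices of smaller levels, neither of which is a permutation matrix. Since $\det W(\Sigma)\ne0$, $Q_0$ exists and is unique. *)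

theory Defs
  imports "Jordan_Normal_Form.Char_Poly" "HOL-Computational_Algebra.Squarefree"
begin

definition oriented_graph :: "nat \<Rightarrow> (nat \<times> nat) set \<Rightarrow> bool" where
  "oriented_graph n A \<longleftrightarrow> A \<subseteq> {0..<n} \<times> {0..<n} \<and>
     (\<forall>i j. (i, j) \<in> A \<longrightarrow> (j, i) \<notin> A)"

definition skew_adj :: "nat \<Rightarrow> (nat \<times> nat) set \<Rightarrow> int mat" where
  "skew_adj n A = mat n n (\<lambda>(i, j). if (i, j) \<in> A then 1 else if (j, i) \<in> A then -1 else 0)"

definition ones_vec :: "nat \<Rightarrow> 'a::one vec" where
  "ones_vec n = vec n (\<lambda>_. 1)"

definition ones_mat :: "nat \<Rightarrow> 'a::one mat" where
  "ones_mat n = mat n n (\<lambda>_. 1)"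

definition perm_mat :: "nat \<Rightarrow> (nat \<Rightarrow> nat) \<Rightarrow> 'a::{zero,one} mat" where
  "perm_mat n p = mat n n (\<lambda>(i, j). if i = p j then 1 else 0)"

definition is_perm_mat :: "nat \<Rightarrow> 'a::{zero,one} mat \<Rightarrow> bool" where
  "is_perm_mat n P \<longleftrightarrow> (\<exists>p. p permutes {0..<n} \<and> P = perm_mat n p)"

definition og_isomorphic :: "nat \<Rightarrow> (nat \<times> nat) set \<Rightarrow> (nat \<times> nat) set \<Rightarrow> bool" where
  "og_isomorphic n A B \<longleftrightarrow>
     (\<exists>P. is_perm_mat n P \<and> transpose_mat P * skew_adj n A * P = skew_adj n B)"

text \<open>Generalized cospectrality: S and J - I - S have the same spectra
  (equality of spectra with multiplicities = equality of characteristic polynomials).\<close>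
definition gen_cospectral :: "nat \<Rightarrow> (nat \<times> nat) set \<Rightarrow> (nat \<times> nat) set \<Rightarrow> bool" where
  "gen_cospectral n A B \<longleftrightarrow>
     char_poly (skew_adj n A) = char_poly (skew_adj n B) \<and>
     char_poly (ones_mat n - 1\<^sub>m n - skew_adj n A) = char_poly (ones_mat n - 1\<^sub>m n - skew_adj n B)"

definition WDGSS :: "nat \<Rightarrow> (nat \<times> nat) set \<Rightarrow> bool" where
  "WDGSS n A \<longleftrightarrow> (\<forall>B. oriented_graph n B \<and> gen_cospectral n A B \<longrightarrow>
      og_isomorphic n A B \<or> og_isomorphic n (A\<inverse>) B)"

definition walk_mat :: "nat \<Rightarrow> int mat \<Rightarrow> int mat" where
  "walk_mat n S = mat n n (\<lambda>(i, j). ((S ^\<^sub>m j) *\<^sub>v ones_vec n) $ i)"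

definition in_G :: "nat \<Rightarrow> (nat \<times> nat) set \<Rightarrow> bool" where
  "in_G n A \<longleftrightarrow> oriented_graph n A \<and>
     (let d = det (walk_mat n (skew_adj n A)) in
        (2::int) ^ (n div 2) dvd d \<and> odd (d div 2 ^ (n div 2)) \<and>
        squarefree (d div 2 ^ (n div 2)))"

definition reg_rat_orth :: "nat \<Rightarrow> rat mat \<Rightarrow> bool" where
  "reg_rat_orth n Q \<longleftrightarrow> Q \<in> carrier_mat n n \<and> transpose_mat Q * Q = 1\<^sub>m n \<and>
     Q *\<^sub>v ones_vec n = ones_vec n"

definition level :: "rat mat \<Rightarrow> nat" where
  "level Q = (LEAST k::nat. 0 < k \<and>
     (\<forall>i < dim_row Q. \<forall>j < dim_col Q. of_nat k * Q $$ (i, j) \<in> \<int>))"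

definition factorable :: "nat \<Rightarrow> rat mat \<Rightarrow> bool" where
  "factorable n Q \<longleftrightarrow> (\<exists>Q1 Q2. reg_rat_orth n Q1 \<and> reg_rat_orth n Q2 \<and>
     level Q1 < level Q \<and> level Q2 < level Q \<and>
     \<not> is_perm_mat n Q1 \<and> \<not> is_perm_mat n Q2 \<and> Q = Q1 * Q2)"

end

theory Submission
  imports Defs "HOL-Number_Theory.Cong"
begin

text \<open>
  Let \<open>B\<close> be generalized cospectral with \<open>A\<close>, with skew-adjacency matrices \<open>T\<close> and \<open>S\<close>. Then
  \<open>Q = W(A) W(B)\<^sup>-\<^sup>1\<close> is regular orthogonal with \<open>Q\<^sup>T S Q = T\<close>, and \<open>R = Q\<^sub>0 Q\<close> satisfies
  \<open>R\<^sup>T S R = -T\<close>. The levels of \<open>Q\<close> and \<open>R\<close> are coprime. Since \<open>Q = Q\<^sub>0\<^sup>T R\<close> and \<open>R = Q\<^sub>0 Q\<close>,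
  both levels then divide the level of \<open>Q\<^sub>0\<close>, hence so does their product, and \<open>Q\<^sub>0 = R Q\<^sup>T\<close> is a
  factorization unless \<open>Q\<close> or \<open>R\<close> is a permutation matrix, that is, unless \<open>B\<close> is isomorphic to
  \<open>A\<close> or to its converse.

  For coprimality at an odd prime \<open>p\<close>: \<open>p\<^sup>2\<close> does not divide \<open>det W\<close>, so the kernels of \<open>W(A)\<^sup>T\<close> and
  \<open>W(B)\<^sup>T\<close> mod \<open>p\<close> are lines. If \<open>p\<close> divided both levels, the integral multiples \<open>M\<close>, \<open>N\<close> of \<open>Q\<close>, \<open>R\<close>
  would be nonzero and proportional mod \<open>p\<close>, and \<open>S M = M T\<close>, \<open>S N = - N T\<close> force \<open>S M = 0\<close> mod \<open>p\<close>,
  which is excluded for the isotropic kernel vectors that make up \<open>M\<close>. At \<open>p = 2\<close> the exact power of 2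
  in \<open>det W\<close> already makes each level odd.
\<close>

subsection \<open>Divisibility of integer vectors and kernels modulo a prime\<close>

definition dvd_vec :: "int \<Rightarrow> int vec \<Rightarrow> bool" where
  "dvd_vec p v \<longleftrightarrow> (\<forall>i < dim_vec v. p dvd v $ i)"

lemma dvd_vecI: "(\<And>i. i < dim_vec v \<Longrightarrow> p dvd v $ i) \<Longrightarrow> dvd_vec p v"
  by (simp add: dvd_vec_def)

lemma dvd_vec_obtain:
  assumes "dvd_vec p v" and "v \<in> carrier_vec n"
  obtains w where "w \<in> carrier_vec n" and "v = p \<cdot>\<^sub>v w"
proof
  show "vec n (\<lambda>i. v $ i div p) \<in> carrier_vec n" by simp
  show "v = p \<cdot>\<^sub>v vec n (\<lambda>i. v $ i div p)"
    using assms by (intro eq_vecI) (auto simp: dvd_vec_def)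
qed

lemma dvd_scalar_prod: "dvd_vec p w \<Longrightarrow> p dvd v \<bullet> w"
  by (auto simp: dvd_vec_def scalar_prod_def intro!: dvd_sum)

lemma dvd_vec_mult_mat_vec: "dvd_vec p v \<Longrightarrow> dvd_vec p (A *\<^sub>v v)"
  by (auto intro!: dvd_vecI dvd_scalar_prod)

lemma prime_dvd_mult_cancel_int:
  fixes p :: int
  assumes "prime p" and "\<not> p dvd a" and "p dvd a * b"
  shows "p dvd b"
  using assms prime_dvd_mult_iff by blast

lemma smult_mat_mult_vec:
  fixes A :: "'a::comm_semiring_0 mat"
  assumes "A \<in> carrier_mat m n" and "v \<in> carrier_vec n"
  shows "(c \<cdot>\<^sub>m A) *\<^sub>v v = c \<cdot>\<^sub>v (A *\<^sub>v v)"
  using assms by (intro eq_vecI) (auto simp: scalar_prod_def sum_distrib_left mult.assoc)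

text \<open>The adjugate turns \<open>A v\<close> into \<open>det A\<close> times \<open>v\<close>,
  so \<open>p\<close> divides the product of \<open>det A\<close> with an entry of \<open>v\<close>
  that is prime to \<open>p\<close>.\<close>

lemma dvd_det_of_dvd_vec:
  fixes A :: "int mat"
  assumes A: "A \<in> carrier_mat n n" and v: "v \<in> carrier_vec n" and p: "prime p"
    and Av: "dvd_vec p (A *\<^sub>v v)" and nz: "\<not> dvd_vec p v"
  shows "p dvd det A"
proof -
  obtain i where i: "i < n" "\<not> p dvd v $ i" using nz v by (auto simp: dvd_vec_def)
  have "adj_mat A *\<^sub>v (A *\<^sub>v v) = det A \<cdot>\<^sub>v v"
    using adj_mat[OF A] A v
    by (simp add: assoc_mult_mat_vec[symmetric, of _ n n _ n] smult_mat_mult_vec[of _ n n])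
  moreover have "dvd_vec p (adj_mat A *\<^sub>v (A *\<^sub>v v))" by (rule dvd_vec_mult_mat_vec[OF Av])
  ultimately have "p dvd det A * v $ i" using i v by (auto simp: dvd_vec_def)
  then show ?thesis using p i prime_dvd_mult_iff by blast
qed

text \<open>Every term of the Leibniz expansion has one factor from each of the two columns;
  transposing first makes the product in a term run over the columns.\<close>

lemma square_dvd_det:
  fixes A :: "int mat"
  assumes A: "A \<in> carrier_mat n n" and ij: "i < n" "j < n" "i \<noteq> j"
    and ci: "dvd_vec p (col A i)" and cj: "dvd_vec p (col A j)"
  shows "p ^ 2 dvd det A"
proof -
  have "det A = det A\<^sup>T" using det_transpose[OF A] by simp
  also have "\<dots> = (\<Sum>\<pi> | \<pi> permutes {0..<n}. signof \<pi> * (\<Prod>k = 0..<n. A\<^sup>T $$ (k, \<pi> k)))"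
    using A by (simp add: det_def')
  also have "p ^ 2 dvd \<dots>"
  proof (rule dvd_sum)
    fix \<pi> assume "\<pi> \<in> {\<pi>. \<pi> permutes {0..<n}}"
    then have \<pi>: "\<pi> k < n" if "k < n" for k using that permutes_in_image by fastforce
    have "(\<Prod>k = 0..<n. A\<^sup>T $$ (k, \<pi> k)) =
        A\<^sup>T $$ (i, \<pi> i) * (A\<^sup>T $$ (j, \<pi> j) * (\<Prod>k \<in> {0..<n} - {i} - {j}. A\<^sup>T $$ (k, \<pi> k)))"
      using ij by (subst prod.remove[of _ i], simp, simp, subst prod.remove[of _ j]) auto
    moreover have "p dvd A\<^sup>T $$ (i, \<pi> i)" "p dvd A\<^sup>T $$ (j, \<pi> j)"
      using ci cj ij A \<pi>[of i] \<pi>[of j] by (auto simp: dvd_vec_def)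
    ultimately show "p ^ 2 dvd signof \<pi> * (\<Prod>k = 0..<n. A\<^sup>T $$ (k, \<pi> k))"
      by (simp add: power2_eq_square mult_dvd_mono dvd_mult dvd_mult2 mult.assoc[symmetric])
  qed
  finally show ?thesis .
qed

text \<open>Cramer's rule replaces column \<open>i\<close> by \<open>W a\<close> and then column
  \<open>j\<close> by a multiple of \<open>W b\<close>, both divisible by \<open>p\<close>, and
  multiplies the determinant only by the minor and by \<open>a $ i\<close>, which is prime to
  \<open>p\<close> after a possible swap. So \<open>p\<close> must divide the minor: the kernel of
  \<open>W\<close> modulo \<open>p\<close> is at most a line.\<close>

lemma kernel_line_mod:
  fixes W :: "int mat"
  assumes W: "W \<in> carrier_mat n n" and p: "prime p" and d: "\<not> p ^ 2 dvd det W"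
    and a: "a \<in> carrier_vec n" and b: "b \<in> carrier_vec n"
    and Wa: "dvd_vec p (W *\<^sub>v a)" and Wb: "dvd_vec p (W *\<^sub>v b)"
    and i: "i < n" and j: "j < n"
  shows "p dvd a $ i * b $ j - b $ i * a $ j"
proof (cases "i = j \<or> p dvd a $ i \<and> p dvd b $ i")
  case True
  then show ?thesis by (auto simp: mult.commute)
next
  case False
  have main: "p dvd a $ i * b $ j - b $ i * a $ j"
    if a: "a \<in> carrier_vec n" and b: "b \<in> carrier_vec n"
      and Wa: "dvd_vec p (W *\<^sub>v a)" and Wb: "dvd_vec p (W *\<^sub>v b)"
      and ai: "\<not> p dvd a $ i" and ij: "i \<noteq> j" for a b
  proof -
    define W1 where "W1 = replace_col W (W *\<^sub>v a) i"
    have W1: "W1 \<in> carrier_mat n n" using W by (simp add: W1_def replace_col_def)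
    \<comment> \<open>Entry \<open>i\<close> weights the new column \<open>W a\<close> by
      \<open>b $ i\<close>; the remaining entries are chosen so that the total is
      \<open>a $ i\<close> times \<open>W b\<close>.\<close>
    define c where "c = vec n (\<lambda>k. if k = i then b $ i else a $ i * b $ k - b $ i * a $ k)"
    have c: "c \<in> carrier_vec n" by (simp add: c_def)
    have W1c: "W1 *\<^sub>v c = a $ i \<cdot>\<^sub>v (W *\<^sub>v b)"
    proof (rule eq_vecI)
      fix r assume "r < dim_vec (a $ i \<cdot>\<^sub>v (W *\<^sub>v b))"
      then have r: "r < n" using W by simp
      have "(W1 *\<^sub>v c) $ r = (\<Sum>k = 0..<n. W1 $$ (r, k) * c $ k)"
        using r W1 c by (simp add: scalar_prod_def)
      also have "\<dots> = W1 $$ (r, i) * c $ i + (\<Sum>k \<in> {0..<n} - {i}. W1 $$ (r, k) * c $ k)"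
        using i by (subst sum.remove[of _ i]) auto
      also have "W1 $$ (r, i) * c $ i = b $ i * (\<Sum>k = 0..<n. W $$ (r, k) * a $ k)"
        using i r W a by (simp add: W1_def c_def replace_col_def scalar_prod_def)
      also have "(\<Sum>k \<in> {0..<n} - {i}. W1 $$ (r, k) * c $ k) =
          (\<Sum>k \<in> {0..<n} - {i}. W $$ (r, k) * (a $ i * b $ k - b $ i * a $ k))"
        using r W by (intro sum.cong) (auto simp: W1_def c_def replace_col_def)
      \<comment> \<open>The restored summand at \<open>k = i\<close> is zero.\<close>
      also have "\<dots> = (\<Sum>k = 0..<n. W $$ (r, k) * (a $ i * b $ k - b $ i * a $ k))"
        using i by (subst (2) sum.remove[of _ i]) auto
      also have "b $ i * (\<Sum>k = 0..<n. W $$ (r, k) * a $ k) + \<dots> =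
          a $ i * (\<Sum>k = 0..<n. W $$ (r, k) * b $ k)"
        unfolding sum_distrib_left sum.distrib[symmetric]
        by (intro sum.cong) (auto simp: algebra_simps)
      finally show "(W1 *\<^sub>v c) $ r = (a $ i \<cdot>\<^sub>v (W *\<^sub>v b)) $ r"
        using r W b by (simp add: scalar_prod_def)
    qed (use W W1 in simp)
    define W2 where "W2 = replace_col W1 (W1 *\<^sub>v c) j"
    have W2: "W2 \<in> carrier_mat n n" using W1 by (simp add: W2_def replace_col_def)
    have "det W2 = c $ j * (a $ i * det W)"
      unfolding W2_def cramer_lemma_mat[OF W1 c j] unfolding W1_def cramer_lemma_mat[OF W a i] ..
    also have "\<dots> = (a $ i * b $ j - b $ i * a $ j) * a $ i * det W"
      using ij j by (simp add: c_def)
    finally have detW2: "det W2 = (a $ i * b $ j - b $ i * a $ j) * a $ i * det W" .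
    have "dvd_vec p (col W2 i)"
      using Wa i j ij W W1 by (auto simp: dvd_vec_def W2_def W1_def replace_col_def)
    moreover have "dvd_vec p (col W2 j)"
      unfolding W2_def W1c
      using Wb i j W W1 by (auto simp: dvd_vec_def replace_col_def)
    ultimately have "p ^ 2 dvd (a $ i * b $ j - b $ i * a $ j) * a $ i * det W"
      using square_dvd_det[OF W2 i j ij] detW2 by simp
    then show ?thesis
      using p d ai
      by (metis mult.assoc mult.commute prime_elem_dvd_mult_iff prime_imp_prime_elem
          coprime_dvd_mult_right_iff prime_imp_coprime_int coprime_power_left_iff)
  qed
  show ?thesis
  proof (cases "p dvd a $ i")
    case True
    then show ?thesis using main[OF b a Wb Wa] False by (simp add: dvd_diff_commute mult.commute)
  next
    case ai: False
    then show ?thesis using main[OF a b Wa Wb] False by simp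
  qed
qed

subsection \<open>Walk matrices of skew-symmetric matrices\<close>

lemma mult_mat_smult_vec:
  fixes A :: "'a::comm_semiring_0 mat"
  assumes "A \<in> carrier_mat m n" and "v \<in> carrier_vec n"
  shows "A *\<^sub>v (c \<cdot>\<^sub>v v) = c \<cdot>\<^sub>v (A *\<^sub>v v)"
  using assms by (intro eq_vecI) auto

definition walk :: "nat \<Rightarrow> int mat \<Rightarrow> nat \<Rightarrow> int vec" where
  "walk n S k = (S ^\<^sub>m k) *\<^sub>v ones_vec n"

text \<open>These integers are all that is extracted from the two characteristic polynomials. By
  skew symmetry they determine every inner product of walk vectors.\<close>

definition walk_count :: "nat \<Rightarrow> int mat \<Rightarrow> nat \<Rightarrow> int" where
  "walk_count n S k = ones_vec n \<bullet> walk n S k"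

lemma ones_vec_carrier [simp]: "ones_vec n \<in> carrier_vec n"
  by (simp add: ones_vec_def)

lemma dim_ones_vec [simp]: "dim_vec (ones_vec n) = n"
  by (simp add: ones_vec_def)

lemma index_ones_vec [simp]: "i < n \<Longrightarrow> ones_vec n $ i = 1"
  by (simp add: ones_vec_def)

lemma walk_carrier [simp]: "S \<in> carrier_mat n n \<Longrightarrow> walk n S k \<in> carrier_vec n"
  unfolding walk_def by (rule mult_mat_vec_carrier[of _ n n]) auto

lemma dim_walk [simp]: "S \<in> carrier_mat n n \<Longrightarrow> dim_vec (walk n S k) = n"
  by (rule carrier_vecD[OF walk_carrier])

lemma walk_mat_carrier [simp]: "walk_mat n S \<in> carrier_mat n n"
  by (simp add: walk_mat_def)

lemma dim_walk_mat [simp]: "dim_row (walk_mat n S) = n" "dim_col (walk_mat n S) = n"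
  by (simp_all add: walk_mat_def)

lemma walk_mat_index: "i < n \<Longrightarrow> j < n \<Longrightarrow> walk_mat n S $$ (i, j) = walk n S j $ i"
  by (simp add: walk_mat_def walk_def)

lemma col_walk_mat: "S \<in> carrier_mat n n \<Longrightarrow> j < n \<Longrightarrow> col (walk_mat n S) j = walk n S j"
  by (intro eq_vecI) (auto simp: walk_mat_index)

lemma pow_mat_commute:
  assumes "S \<in> carrier_mat n n"
  shows "S * S ^\<^sub>m k = S ^\<^sub>m k * S"
proof (induction k)
  case (Suc k)
  have "S * S ^\<^sub>m Suc k = (S * S ^\<^sub>m k) * S"
    using assms by (simp add: assoc_mult_mat[of _ n n _ n _ n])
  then show ?case using Suc by simp
qed (use assms in simp)

lemma walk_0: "S \<in> carrier_mat n n \<Longrightarrow> walk n S 0 = ones_vec n"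
  by (simp add: walk_def)

lemma walk_Suc:
  assumes "S \<in> carrier_mat n n"
  shows "walk n S (Suc k) = S *\<^sub>v walk n S k"
  using assms by (simp add: walk_def pow_mat_commute[symmetric] assoc_mult_mat_vec[of _ n n _ n])

lemma walk_mat_mult_vec:
  assumes "f \<in> carrier_vec n" and "i < n"
  shows "(walk_mat n S *\<^sub>v f) $ i = (\<Sum>j < n. walk n S j $ i * f $ j)"
  using assms by (auto simp: scalar_prod_def walk_mat_index atLeast0LessThan intro!: sum.cong)

text \<open>For coefficient vectors of polynomials of degree below \<open>n\<close>, this is
  multiplication by the variable with the top coefficient dropped.\<close>

definition shift_vec :: "nat \<Rightarrow> int vec \<Rightarrow> int vec" where
  "shift_vec n f = vec n (\<lambda>i. if i = 0 then 0 else f $ (i - 1))"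

lemma shift_vec_carrier [simp]: "shift_vec n f \<in> carrier_vec n"
  by (simp add: shift_vec_def)

lemma dim_shift_vec [simp]: "dim_vec (shift_vec n f) = n"
  by (simp add: shift_vec_def)

text \<open>The vector \<open>W f\<close> is \<open>f(S) e\<close>, so applying \<open>S\<close>
  multiplies the polynomial by its variable. The top coefficient overflows into a walk vector that
  is not a column of \<open>W\<close>.\<close>

lemma walk_mat_shift:
  assumes S: "S \<in> carrier_mat (Suc m) (Suc m)" and f: "f \<in> carrier_vec (Suc m)"
  shows "S *\<^sub>v (walk_mat (Suc m) S *\<^sub>v f) =
    walk_mat (Suc m) S *\<^sub>v shift_vec (Suc m) f + f $ m \<cdot>\<^sub>v walk (Suc m) S (Suc m)"
proof (rule eq_vecI)
  fix i assume "i < dim_vec (walk_mat (Suc m) S *\<^sub>v shift_vec (Suc m) f +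
    f $ m \<cdot>\<^sub>v walk (Suc m) S (Suc m))"
  then have i: "i < Suc m" using S by simp
  have "(S *\<^sub>v (walk_mat (Suc m) S *\<^sub>v f)) $ i =
      (\<Sum>k < Suc m. S $$ (i, k) * (\<Sum>j < Suc m. walk (Suc m) S j $ k * f $ j))"
    using i S f walk_mat_mult_vec[OF f]
    by (auto simp: scalar_prod_def atLeast0LessThan simp del: sum.lessThan_Suc intro!: sum.cong)
  also have "\<dots> = (\<Sum>j < Suc m. (\<Sum>k < Suc m. S $$ (i, k) * walk (Suc m) S j $ k) * f $ j)"
    unfolding sum_distrib_left sum_distrib_right
    by (subst sum.swap) (simp add: mult.assoc del: sum.lessThan_Suc)
  also have "\<dots> = (\<Sum>j < Suc m. walk (Suc m) S (Suc j) $ i * f $ j)"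
  proof (intro sum.cong refl)
    fix j
    have "(\<Sum>k < Suc m. S $$ (i, k) * walk (Suc m) S j $ k) = (S *\<^sub>v walk (Suc m) S j) $ i"
      using i S by (auto simp: scalar_prod_def atLeast0LessThan simp del: sum.lessThan_Suc)
    then show "(\<Sum>k < Suc m. S $$ (i, k) * walk (Suc m) S j $ k) * f $ j =
        walk (Suc m) S (Suc j) $ i * f $ j"
      using walk_Suc[OF S] by simp
  qed
  also have "\<dots> = (\<Sum>j < m. walk (Suc m) S (Suc j) $ i * f $ j) + walk (Suc m) S (Suc m) $ i * f $ m"
    by simp
  also have "(\<Sum>j < m. walk (Suc m) S (Suc j) $ i * f $ j) =
      (\<Sum>j < Suc m. walk (Suc m) S j $ i * shift_vec (Suc m) f $ j)"
    by (subst sum.lessThan_Suc_shift) (simp add: shift_vec_def)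
  also have "\<dots> = (walk_mat (Suc m) S *\<^sub>v shift_vec (Suc m) f) $ i"
    using walk_mat_mult_vec[OF shift_vec_carrier i] by simp
  finally show "(S *\<^sub>v (walk_mat (Suc m) S *\<^sub>v f)) $ i = (walk_mat (Suc m) S *\<^sub>v shift_vec (Suc m) f +
    f $ m \<cdot>\<^sub>v walk (Suc m) S (Suc m)) $ i"
    using i S by (simp add: mult.commute)
qed (use S in auto)

section \<open>Skew symmetry and the kernels of walk matrices modulo a prime\<close>

lemma skew_scalar_prod:
  fixes S :: "int mat"
  assumes S: "S \<in> carrier_mat n n" and skew: "S\<^sup>T = - S"
    and v: "v \<in> carrier_vec n" and w: "w \<in> carrier_vec n"
  shows "v \<bullet> (S *\<^sub>v w) = - ((S *\<^sub>v v) \<bullet> w)"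
proof -
  have "v \<bullet> (S *\<^sub>v w) = (S\<^sup>T *\<^sub>v v) \<bullet> w"
    using transpose_vec_mult_scalar[OF S w v] by simp
  also have "S\<^sup>T *\<^sub>v v = - (S *\<^sub>v v)" unfolding skew using S v by simp
  finally show ?thesis using S w by simp
qed

lemma skew_scalar_prod_self:
  fixes S :: "int mat"
  assumes "S \<in> carrier_mat n n" and "S\<^sup>T = - S" and "v \<in> carrier_vec n"
  shows "v \<bullet> (S *\<^sub>v v) = 0"
  using skew_scalar_prod[OF assms assms(3)] comm_scalar_prod[OF assms(3), of "S *\<^sub>v v"]
    mult_mat_vec_carrier[OF assms(1,3)]
  by simp

text \<open>The product \<open>adj_mat W * W\<close> is a multiple of \<open>p\<close>, so the rows
  of the adjugate lie in the left kernel of \<open>W\<close> modulo \<open>p\<close> and are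
  proportional to \<open>z\<close>. Hence \<open>adj_mat W\<close> sees a vector \<open>x\<close>
  modulo \<open>p\<close> only through \<open>z \<bullet> x\<close>.\<close>

lemma adj_mat_mult_vec_mod:
  fixes W :: "int mat"
  assumes W: "W \<in> carrier_mat n n" and p: "prime p" and d: "\<not> p ^ 2 dvd det W" "p dvd det W"
    and z: "z \<in> carrier_vec n" and Wz: "dvd_vec p (W\<^sup>T *\<^sub>v z)"
    and x: "x \<in> carrier_vec n" and i: "i < n" and a: "a < n"
  shows "p dvd z $ a * (adj_mat W *\<^sub>v x) $ i - adj_mat W $$ (i, a) * (z \<bullet> x)"
proof -
  note Ad = adj_mat[OF W]
  have row: "row (adj_mat W) i \<in> carrier_vec n" using Ad(1) i by simp
  have "W\<^sup>T *\<^sub>v row (adj_mat W) i = row (adj_mat W * W) i"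
    using Ad(1) W i by (intro eq_vecI) (auto intro!: comm_scalar_prod[of _ n])
  then have "dvd_vec p (W\<^sup>T *\<^sub>v row (adj_mat W) i)"
    unfolding Ad(3) using i d by (auto simp: dvd_vec_def)
  then have "p dvd z $ a * row (adj_mat W) i $ j - row (adj_mat W) i $ a * z $ j" if "j < n" for j
    using kernel_line_mod[of "W\<^sup>T" n p z "row (adj_mat W) i" a j] row Wz W p d z Ad(1) a that
    by (simp add: det_transpose[OF W])
  then have "p dvd (z $ a * adj_mat W $$ (i, j) - adj_mat W $$ (i, a) * z $ j) * x $ j" if "j < n" for j
    using that Ad(1) i a by simp
  then have "p dvd (\<Sum>j = 0..<n. (z $ a * adj_mat W $$ (i, j) - adj_mat W $$ (i, a) * z $ j) * x $ j)"
    by (intro dvd_sum) auto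
  also have "\<dots> = z $ a * (adj_mat W *\<^sub>v x) $ i - adj_mat W $$ (i, a) * (z \<bullet> x)"
    using i Ad(1) x by (simp add: scalar_prod_def sum_distrib_left algebra_simps sum_subtractf)
  finally show ?thesis .
qed

text \<open>The columns of the adjugate lie in the kernel modulo \<open>p\<close>. Were they all
  zero modulo \<open>p\<close>, dividing by \<open>p\<close> would give \<open>W * X = u I\<close>
  with \<open>u = det W / p\<close>; taking determinants, \<open>p\<close> divides a power of
  \<open>u\<close>, hence \<open>u\<close>, against the assumption on \<open>p ^ 2\<close>.\<close>

lemma kernel_mod_exists:
  fixes W :: "int mat"
  assumes W: "W \<in> carrier_mat n n" and p: "prime p" and d: "\<not> p ^ 2 dvd det W" "p dvd det W"
  obtains m where "m \<in> carrier_vec n" and "dvd_vec p (W *\<^sub>v m)" and "\<not> dvd_vec p m"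
proof -
  note Ad = adj_mat[OF W]
  have "\<exists>j < n. \<not> dvd_vec p (col (adj_mat W) j)"
  proof (rule ccontr)
    assume "\<not> ?thesis"
    then have *: "p dvd adj_mat W $$ (i, j)" if "i < n" "j < n" for i j
      using that Ad(1) by (auto simp: dvd_vec_def)
    define X where "X = mat n n (\<lambda>(i, j). adj_mat W $$ (i, j) div p)"
    have X: "X \<in> carrier_mat n n" by (simp add: X_def)
    have AX: "adj_mat W = p \<cdot>\<^sub>m X" using * Ad(1) by (intro eq_matI) (auto simp: X_def)
    obtain u where u: "det W = p * u" using d by auto
    have p0: "p \<noteq> 0" using p by auto
    have "p \<cdot>\<^sub>m (W * X) = p \<cdot>\<^sub>m (u \<cdot>\<^sub>m 1\<^sub>m n)"
      using Ad(2) unfolding AX u using W X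
      by (simp add: mult_smult_distrib[of _ n n _ n]) (intro eq_matI, auto)
    then have "W * X = u \<cdot>\<^sub>m 1\<^sub>m n"
      using p0 W X by (auto simp: mat_eq_iff)
    then have "det W * det X = u ^ n"
      using det_mult[OF W X] by simp
    then have "p dvd u ^ n" using u by (metis dvd_mult2 dvd_triv_left mult.assoc)
    then have "p dvd u" using p prime_dvd_power by blast
    then show False using d(1) u by (auto simp: power2_eq_square)
  qed
  then obtain j where j: "j < n" "\<not> dvd_vec p (col (adj_mat W) j)" by blast
  have "W *\<^sub>v col (adj_mat W) j = col (W * adj_mat W) j"
    using W Ad(1) j by (intro eq_vecI) auto
  then have "dvd_vec p (W *\<^sub>v col (adj_mat W) j)"
    unfolding Ad(2) using d(2) j by (auto simp: dvd_vec_def)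
  then show ?thesis using that[OF _ _ j(2)] Ad(1) j by auto
qed

text \<open>If the last entry vanished modulo \<open>p\<close>, no overflow would occur and the
  shift of \<open>m\<close> would lie in the kernel too, hence be proportional to \<open>m\<close>.
  But the shift moves the first nonzero entry one place to the right.\<close>

lemma walk_kernel_last:
  assumes S: "S \<in> carrier_mat (Suc k) (Suc k)" and p: "prime p"
    and d: "\<not> p ^ 2 dvd det (walk_mat (Suc k) S)"
    and m: "m \<in> carrier_vec (Suc k)" and Wm: "dvd_vec p (walk_mat (Suc k) S *\<^sub>v m)"
    and nz: "\<not> dvd_vec p m"
  shows "\<not> p dvd m $ k"
proof
  assume last: "p dvd m $ k"
  define i where "i = (LEAST i. i < Suc k \<and> \<not> p dvd m $ i)"
  have ex: "\<exists>i. i < Suc k \<and> \<not> p dvd m $ i" using nz m by (auto simp: dvd_vec_def)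
  have i: "i < Suc k" "\<not> p dvd m $ i" using LeastI_ex[OF ex] by (auto simp: i_def)
  have less: "p dvd m $ j" if "j < i" for j
    using not_less_Least[of j "\<lambda>i. i < Suc k \<and> \<not> p dvd m $ i"] that i by (auto simp: i_def)
  have ik: "i < k" using i last by (cases "i = k") auto
  let ?W = "walk_mat (Suc k) S"
  have "?W *\<^sub>v shift_vec (Suc k) m = S *\<^sub>v (?W *\<^sub>v m) - m $ k \<cdot>\<^sub>v walk (Suc k) S (Suc k)"
    unfolding walk_mat_shift[OF S m] using S by (intro eq_vecI) auto
  moreover have "dvd_vec p (S *\<^sub>v (?W *\<^sub>v m))" by (rule dvd_vec_mult_mat_vec[OF Wm])
  ultimately have "dvd_vec p (?W *\<^sub>v shift_vec (Suc k) m)"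
    using last S by (auto simp: dvd_vec_def)
  \<comment> \<open>The minor at positions \<open>i\<close> and \<open>Suc i\<close> is the square
    of \<open>m $ i\<close> up to a term containing \<open>m $ (i - 1)\<close>, which
    \<open>p\<close> divides by the choice of \<open>i\<close>.\<close>
  from kernel_line_mod[OF walk_mat_carrier p d m shift_vec_carrier Wm this i(1), of "Suc i"]
  have "p dvd m $ i * m $ i - (if i = 0 then 0 else m $ (i - 1)) * m $ Suc i"
    using ik by (simp add: shift_vec_def)
  moreover have "p dvd (if i = 0 then 0 else m $ (i - 1)) * m $ Suc i"
    using less[of "i - 1"] by auto
  ultimately have "p dvd m $ i * m $ i" by (simp add: dvd_diff_left_iff dvd_diff_right_iff)
  then show False using p i prime_dvd_mult_iff by blast
qed

text \<open>A vector \<open>z\<close> in the left kernel of \<open>W\<close> mod \<open>p\<close> which is isotropic is, up to a unit, \<open>W f\<close> with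
  \<open>f\<close> of last entry 0, so \<open>S z\<close> is \<open>W\<close> applied to the shift of \<open>f\<close>. If \<open>p\<close> divides \<open>S z\<close> then
  \<open>y = S z / p\<close> lies outside the column lattice of \<open>W\<close>, although \<open>z \<bullet> y = 0\<close>.\<close>
lemma isotropic_kernel_not_annihilated:
  assumes S: "S \<in> carrier_mat n n" and skew: "S\<^sup>T = - S" and p: "prime p"
    and d: "\<not> p ^ 2 dvd det (walk_mat n S)"
    and z: "z \<in> carrier_vec n" and Wz: "dvd_vec p ((walk_mat n S)\<^sup>T *\<^sub>v z)"
    and Sz: "dvd_vec p (S *\<^sub>v z)" and zz: "p dvd z \<bullet> z"
  shows "dvd_vec p z"
proof (rule ccontr)
  assume nz: "\<not> dvd_vec p z"
  then obtain a where a: "a < n" "\<not> p dvd z $ a" using z by (auto simp: dvd_vec_def)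
  then obtain k where n: "n = Suc k" by (cases n) auto
  define W where "W = walk_mat n S"
  have W: "W \<in> carrier_mat n n" by (simp add: W_def)
  note d = d[folded W_def] and Wz = Wz[folded W_def]
  have p0: "p \<noteq> 0" using p by auto
  have pd: "p dvd det W"
    using dvd_det_of_dvd_vec[of "W\<^sup>T" n z p] Wz z W p nz by (simp add: det_transpose[OF W])
  then obtain u where u: "det W = p * u" by auto
  have pu: "\<not> p dvd u" using d u by (auto simp: power2_eq_square)
  note Ad = adj_mat[OF W]
  \<comment> \<open>Orthogonality to \<open>z\<close> modulo \<open>p\<close> is the criterion for
    \<open>u x\<close> to be in the column lattice of \<open>W\<close>: then
    \<open>adj_mat W *\<^sub>v x\<close> can be divided by \<open>p\<close>, and \<open>W\<close>
    maps the quotient to \<open>u x\<close>.\<close>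
  have Admod: "dvd_vec p (adj_mat W *\<^sub>v x)" if x: "x \<in> carrier_vec n" "p dvd z \<bullet> x" for x
  proof (rule dvd_vecI)
    fix i assume "i < dim_vec (adj_mat W *\<^sub>v x)"
    then have "p dvd z $ a * (adj_mat W *\<^sub>v x) $ i - adj_mat W $$ (i, a) * (z \<bullet> x)"
      using adj_mat_mult_vec_mod[OF W p d pd z Wz x(1) _ a(1)] Ad(1) by simp
    then have "p dvd z $ a * (adj_mat W *\<^sub>v x) $ i"
      using x(2) by (metis dvd_mult dvd_diff_left_iff)
    then show "p dvd (adj_mat W *\<^sub>v x) $ i" using prime_dvd_mult_cancel_int[OF p a(2)] by blast
  qed
  obtain f0 where f0: "f0 \<in> carrier_vec n" "adj_mat W *\<^sub>v z = p \<cdot>\<^sub>v f0"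
    using dvd_vec_obtain[OF Admod[OF z zz] mult_mat_vec_carrier[OF Ad(1) z]] .
  have "p \<cdot>\<^sub>v (W *\<^sub>v f0) = W *\<^sub>v (adj_mat W *\<^sub>v z)"
    unfolding f0(2) using W f0(1) by (simp add: mult_mat_smult_vec[of _ n n])
  also have "\<dots> = p \<cdot>\<^sub>v (u \<cdot>\<^sub>v z)"
    using Ad W z u by (simp add: assoc_mult_mat_vec[symmetric, of _ n n _ n] smult_mat_mult_vec[of _ n n]
        smult_smult_assoc)
  finally have Wf0: "W *\<^sub>v f0 = u \<cdot>\<^sub>v z"
    using p0 W f0(1) z by (auto simp: vec_eq_iff)
  obtain m where m: "m \<in> carrier_vec n" "dvd_vec p (W *\<^sub>v m)" "\<not> dvd_vec p m"
    using kernel_mod_exists[OF W p d pd] by blast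
  have mk: "\<not> p dvd m $ k"
    using walk_kernel_last[of S k p m] S p d m by (simp add: n W_def)
  \<comment> \<open>Correcting \<open>f0\<close> by the kernel vector \<open>m\<close> makes the
    last entry exactly zero, while \<open>W f\<close> stays a unit multiple of \<open>z\<close>
    modulo \<open>p\<close> because \<open>m $ k\<close> and \<open>u\<close> are prime to
    \<open>p\<close>.\<close>
  define f where "f = m $ k \<cdot>\<^sub>v f0 - f0 $ k \<cdot>\<^sub>v m"
  have f: "f \<in> carrier_vec n" using f0 m by (simp add: f_def)
  have fk: "f $ k = 0" using f0 m n by (simp add: f_def)
  have Wf: "W *\<^sub>v f = (m $ k * u) \<cdot>\<^sub>v z - f0 $ k \<cdot>\<^sub>v (W *\<^sub>v m)"
    unfolding f_def using W f0(1) m(1) Wf0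
    by (subst mult_minus_distrib_mat_vec[of _ n n]) (auto simp: mult_mat_smult_vec[of _ n n] smult_smult_assoc)
  define z2 where "z2 = W *\<^sub>v f"
  have z2: "z2 \<in> carrier_vec n" unfolding z2_def using W f by (rule mult_mat_vec_carrier)
  define c where "c = m $ k * u"
  have pc: "\<not> p dvd c" using mk pu p by (simp add: c_def prime_dvd_mult_iff)
  have z2z: "p dvd z2 $ i - c * z $ i" if "i < n" for i
    unfolding z2_def Wf using that m(2) W z m(1) by (auto simp: c_def dvd_vec_def)
  have Sz2: "S *\<^sub>v z2 = W *\<^sub>v shift_vec n f"
    using walk_mat_shift[of S k f] S f fk n by (simp add: z2_def W_def) (intro eq_vecI, auto)
  have "dvd_vec p (S *\<^sub>v z2)"
  proof -
    have "S *\<^sub>v z2 = c \<cdot>\<^sub>v (S *\<^sub>v z) - f0 $ k \<cdot>\<^sub>v (S *\<^sub>v (W *\<^sub>v m))"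
      unfolding z2_def Wf c_def[symmetric] using S z W m(1)
      by (subst mult_minus_distrib_mat_vec[of _ n n]) (auto simp: mult_mat_smult_vec[of _ n n])
    moreover have "dvd_vec p (S *\<^sub>v (W *\<^sub>v m))" by (rule dvd_vec_mult_mat_vec[OF m(2)])
    ultimately show ?thesis using Sz S by (auto simp: dvd_vec_def)
  qed
  then obtain y where y: "y \<in> carrier_vec n" "S *\<^sub>v z2 = p \<cdot>\<^sub>v y"
    using dvd_vec_obtain[OF _ mult_mat_vec_carrier[OF S z2]] by metis
  have "p * (z2 \<bullet> y) = z2 \<bullet> (S *\<^sub>v z2)" using y z2 by simp
  then have zy: "z2 \<bullet> y = 0" using skew_scalar_prod_self[OF S skew z2] p0 by simp
  have "p dvd (\<Sum>i = 0..<n. (z2 $ i - c * z $ i) * y $ i)"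
    using z2z by (intro dvd_sum) auto
  also have "\<dots> = z2 \<bullet> y - c * (z \<bullet> y)"
    using y by (simp add: scalar_prod_def sum_subtractf sum_distrib_left algebra_simps)
  \<comment> \<open>Skewness thus puts \<open>y\<close> under the criterion \<open>Admod\<close>,
    and the preimage found there is \<open>u\<close> times the shift of \<open>f\<close> divided by
    \<open>p\<close>. This forces the shift to vanish modulo \<open>p\<close>.\<close>
  finally have "p dvd z \<bullet> y" using zy pc p prime_dvd_mult_iff by auto
  from Admod[OF y(1) this] have Ady: "dvd_vec p (adj_mat W *\<^sub>v y)" .
  have "p \<cdot>\<^sub>v (adj_mat W *\<^sub>v y) = adj_mat W *\<^sub>v (W *\<^sub>v shift_vec n f)"
    unfolding Sz2[symmetric] y(2) using Ad(1) y by (simp add: mult_mat_smult_vec[of _ n n])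
  also have "\<dots> = p \<cdot>\<^sub>v (u \<cdot>\<^sub>v shift_vec n f)"
    using Ad W u by (simp add: assoc_mult_mat_vec[symmetric, of _ n n _ n] smult_mat_mult_vec[of _ n n]
        smult_smult_assoc)
  finally have "adj_mat W *\<^sub>v y = u \<cdot>\<^sub>v shift_vec n f"
    using p0 Ad(1) y by (auto simp: vec_eq_iff)
  then have "p dvd u * shift_vec n f $ i" if "i < n" for i
    using Ady that by (auto simp: dvd_vec_def)
  then have sh: "p dvd shift_vec n f $ i" if "i < n" for i
    using that prime_dvd_mult_cancel_int[OF p pu] by blast
  \<comment> \<open>The shift loses only the last entry of \<open>f\<close>, which is zero.\<close>
  have "p dvd f $ i" if "i < n" for i
    using sh[of "Suc i"] fk that n by (cases "i = k") (auto simp: shift_vec_def)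
  then have "dvd_vec p z2" unfolding z2_def using f by (intro dvd_vec_mult_mat_vec) (auto simp: dvd_vec_def)
  then have "p dvd z2 $ a" using z2 a by (auto simp: dvd_vec_def)
  then have "p dvd c * z $ a" using z2z[OF a(1)] by (simp add: dvd_diff_right_iff)
  then show False using pc a(2) p prime_dvd_mult_iff by blast
qed

text \<open>Modulo \<open>p\<close> the columns of \<open>M\<close> and \<open>N\<close> lie on one
  line and their rows on another, so both matrices are multiples of a single rank-one matrix.
  Proportional matrices cannot intertwine \<open>S\<close> with both \<open>T\<close> and
  \<open>- T\<close> unless \<open>S\<close> annihilates them, since 2 is invertible.\<close>

lemma intertwiners_not_both_nonzero_mod:
  fixes M N :: "int mat"
  assumes S: "S \<in> carrier_mat n n" and skew: "S\<^sup>T = - S" and T: "T \<in> carrier_mat n n"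
    and M: "M \<in> carrier_mat n n" and N: "N \<in> carrier_mat n n"
    and p: "prime p" "\<not> p dvd 2"
    and dS: "\<not> p ^ 2 dvd det (walk_mat n S)" and dT: "\<not> p ^ 2 dvd det (walk_mat n T)"
    and Mc: "\<And>j. j < n \<Longrightarrow> dvd_vec p ((walk_mat n S)\<^sup>T *\<^sub>v col M j)"
    and Mr: "\<And>i. i < n \<Longrightarrow> dvd_vec p ((walk_mat n T)\<^sup>T *\<^sub>v row M i)"
    and Nc: "\<And>j. j < n \<Longrightarrow> dvd_vec p ((walk_mat n S)\<^sup>T *\<^sub>v col N j)"
    and Nr: "\<And>i. i < n \<Longrightarrow> dvd_vec p ((walk_mat n T)\<^sup>T *\<^sub>v row N i)"
    and iso: "\<And>j. j < n \<Longrightarrow> p dvd col M j \<bullet> col M j"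
    and SM: "S * M = M * T" and SN: "S * N = - (N * T)"
  shows "(\<forall>i < n. \<forall>j < n. p dvd M $$ (i, j)) \<or> (\<forall>i < n. \<forall>j < n. p dvd N $$ (i, j))"
proof (rule ccontr)
  assume "\<not> ?thesis"
  then obtain a b c d where ab: "a < n" "b < n" "\<not> p dvd M $$ (a, b)"
    and cd: "c < n" "d < n" "\<not> p dvd N $$ (c, d)" by blast
  have colkl: "p dvd x $ i * y $ j - y $ i * x $ j"
    if "x \<in> carrier_vec n" "y \<in> carrier_vec n" "dvd_vec p ((walk_mat n S)\<^sup>T *\<^sub>v x)"
      "dvd_vec p ((walk_mat n S)\<^sup>T *\<^sub>v y)" "i < n" "j < n" for x y i j
    using kernel_line_mod[of "(walk_mat n S)\<^sup>T" n p x y i j] that p dS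
    by (simp add: det_transpose[OF walk_mat_carrier])
  have rowkl: "p dvd x $ i * y $ j - y $ i * x $ j"
    if "x \<in> carrier_vec n" "y \<in> carrier_vec n" "dvd_vec p ((walk_mat n T)\<^sup>T *\<^sub>v x)"
      "dvd_vec p ((walk_mat n T)\<^sup>T *\<^sub>v y)" "i < n" "j < n" for x y i j
    using kernel_line_mod[of "(walk_mat n T)\<^sup>T" n p x y i j] that p dT
    by (simp add: det_transpose[OF walk_mat_carrier])
  define s where "s = M $$ (a, b)"
  define t where "t = N $$ (a, b)"
  have propor: "p dvd s * N $$ (i, j) - t * M $$ (i, j)" if ij: "i < n" "j < n" for i j
  proof -
    have c1: "p dvd s * N $$ (i, j) - N $$ (a, j) * M $$ (i, b)"
      using colkl[of "col M b" "col N j" a i] Mc[OF ab(2)] Nc[OF ij(2)] M N ab ij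
      by (simp add: s_def)
    have r1: "p dvd s * N $$ (a, j) - t * M $$ (a, j)"
      using rowkl[of "row M a" "row N a" b j] Mr[OF ab(1)] Nr[OF ab(1)] M N ab ij
      by (simp add: s_def t_def)
    have c2: "p dvd s * M $$ (i, j) - M $$ (a, j) * M $$ (i, b)"
      using colkl[of "col M b" "col M j" a i] Mc[OF ab(2)] Mc[OF ij(2)] M ab ij
      by (simp add: s_def)
    \<comment> \<open>The chain is
      \<open>s s N(i,j) = s N(a,j) M(i,b) = t M(a,j) M(i,b) = s t M(i,j)\<close> modulo
      \<open>p\<close>: a column minor, a row minor, a column minor.\<close>
    have "s * (s * N $$ (i, j) - t * M $$ (i, j)) =
        s * (s * N $$ (i, j) - N $$ (a, j) * M $$ (i, b)) +
        (s * N $$ (a, j) - t * M $$ (a, j)) * M $$ (i, b) -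
        t * (s * M $$ (i, j) - M $$ (a, j) * M $$ (i, b))"
      by (simp add: algebra_simps)
    then have "p dvd s * (s * N $$ (i, j) - t * M $$ (i, j))"
      using c1 r1 c2 by (metis dvd_add dvd_diff dvd_mult dvd_mult2)
    then show ?thesis using prime_dvd_mult_cancel_int[OF p(1)] ab(3) unfolding s_def by blast
  qed
  have ps: "\<not> p dvd s" using ab by (simp add: s_def)
  have pt: "\<not> p dvd t"
  proof
    assume "p dvd t"
    then have "p dvd s * N $$ (c, d)" using propor[OF cd(1,2)] by (simp add: dvd_diff_left_iff)
    then show False using ps cd(3) p(1) prime_dvd_mult_iff by blast
  qed
  have SM0: "p dvd (S * M) $$ (i, j)" if ij: "i < n" "j < n" for i j
  proof -
    have "p dvd (\<Sum>k = 0..<n. S $$ (i, k) * (s * N $$ (k, j) - t * M $$ (k, j)))"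
      using propor ij by (intro dvd_sum) auto
    also have "\<dots> = s * (S * N) $$ (i, j) - t * (S * M) $$ (i, j)"
      using ij S M N by (simp add: scalar_prod_def sum_subtractf sum_distrib_left algebra_simps)
    finally have 1: "p dvd s * (S * N) $$ (i, j) - t * (S * M) $$ (i, j)" .
    have "p dvd (\<Sum>k = 0..<n. (s * N $$ (i, k) - t * M $$ (i, k)) * T $$ (k, j))"
      using propor ij by (intro dvd_sum) auto
    also have "\<dots> = s * (N * T) $$ (i, j) - t * (M * T) $$ (i, j)"
      using ij T M N by (simp add: scalar_prod_def sum_subtractf sum_distrib_left algebra_simps)
    also have "\<dots> = - (s * (S * N) $$ (i, j)) - t * (S * M) $$ (i, j)"
      unfolding SN SM using ij N T by simp
    finally have 2: "p dvd - (s * (S * N) $$ (i, j)) - t * (S * M) $$ (i, j)" .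
    \<comment> \<open>Adding the two congruences cancels the terms in \<open>S * N\<close>; oddness
      of \<open>p\<close> then removes the factor 2.\<close>
    have "p dvd - (2 * t) * (S * M) $$ (i, j)" using dvd_add[OF 1 2] by (simp add: algebra_simps)
    then show ?thesis using p pt by (simp add: prime_dvd_mult_iff)
  qed
  have "dvd_vec p (S *\<^sub>v col M b)"
    using SM0 S M ab by (auto simp: dvd_vec_def)
  then have "dvd_vec p (col M b)"
    using isotropic_kernel_not_annihilated[OF S skew p(1) dS _ Mc[OF ab(2)] _ iso[OF ab(2)]] M ab by auto
  then show False using ab M by (auto simp: dvd_vec_def)
qed

section \<open>Walk counts of skew matrices and their parity\<close>

lemma walk_scalar_prod:
  assumes "S \<in> carrier_mat n n" and "S\<^sup>T = - S"
  shows "walk n S i \<bullet> walk n S j = (-1) ^ i * walk_count n S (i + j)"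
proof (induction i arbitrary: j)
  case 0
  then show ?case using assms by (simp add: walk_0 walk_count_def)
next
  case (Suc i)
  have "walk n S (Suc i) \<bullet> walk n S j = - (walk n S i \<bullet> walk n S (Suc j))"
    using skew_scalar_prod[OF assms, of "walk n S i" "walk n S j"] assms by (simp add: walk_Suc)
  then show ?case using Suc by simp
qed

lemma walk_count_odd:
  assumes "S \<in> carrier_mat n n" and "S\<^sup>T = - S" and "odd m"
  shows "walk_count n S m = 0"
proof -
  obtain l where m: "m = 2 * l + 1" using \<open>odd m\<close> oddE by blast
  have "walk n S l \<bullet> walk n S (Suc l) = 0"
    using skew_scalar_prod_self[OF assms(1,2), of "walk n S l"] assms by (simp add: walk_Suc)
  then show ?thesis using walk_scalar_prod[OF assms(1,2), of l "Suc l"] by (simp add: m mult_2)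
qed

lemma even_scalar_prod_self: "even (v \<bullet> v) = even (ones_vec (dim_vec v) \<bullet> v)" for v :: "int vec"
proof -
  have "even (\<Sum>i = 0..<dim_vec v. v $ i * v $ i - v $ i)"
    by (intro dvd_sum) auto
  then show ?thesis by (simp add: scalar_prod_def sum_subtractf)
qed

text \<open>For \<open>m = 2 l\<close> the count is, up to sign, the square norm of the
  \<open>l\<close>-th walk vector, which has the parity of the count at \<open>l\<close>. Halving
  ends at an odd index, where the count is zero.\<close>

lemma walk_count_even:
  assumes "S \<in> carrier_mat n n" and "S\<^sup>T = - S" and "m > 0"
  shows "even (walk_count n S m)"
  using \<open>m > 0\<close>
proof (induction m rule: less_induct)
  case (less m)
  show ?case
  proof (cases "odd m")
    case True
    then show ?thesis using walk_count_odd[OF assms(1,2)] by simp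
  next
    case False
    then obtain l where m: "m = 2 * l" by blast
    have "even (walk n S l \<bullet> walk n S l)"
      using less.IH[of l] less.prems m assms by (simp add: even_scalar_prod_self walk_count_def)
    then show ?thesis using walk_scalar_prod[OF assms(1,2), of l l] by (simp add: m mult_2)
  qed
qed

lemma det_scale_rows:
  fixes A :: "'a::comm_ring_1 mat"
  assumes "A \<in> carrier_mat n n"
  shows "det (mat n n (\<lambda>(i, j). c i * A $$ (i, j))) = (\<Prod>i < n. c i) * det A"
proof -
  have "(\<Prod>i = 0..<n. mat n n (\<lambda>(i, j). c i * A $$ (i, j)) $$ (i, \<pi> i)) =
      (\<Prod>i < n. c i) * (\<Prod>i = 0..<n. A $$ (i, \<pi> i))" if "\<pi> permutes {0..<n}" for \<pi>
  proof -
    have "\<pi> i < n" if "i < n" for i using \<open>\<pi> permutes {0..<n}\<close> that permutes_in_image by fastforce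
    then have "(\<Prod>i = 0..<n. mat n n (\<lambda>(i, j). c i * A $$ (i, j)) $$ (i, \<pi> i)) =
      (\<Prod>i = 0..<n. c i * A $$ (i, \<pi> i))" by (intro prod.cong) auto
    then show ?thesis by (simp add: prod.distrib atLeast0LessThan)
  qed
  then show ?thesis
    using assms by (simp add: det_def'[of _ n] sum_distrib_left algebra_simps)
qed

lemma mult_mat_vec_inj:
  fixes A :: "int mat"
  assumes A: "A \<in> carrier_mat n n" and d: "det A \<noteq> 0"
    and v: "v \<in> carrier_vec n" and w: "w \<in> carrier_vec n" and eq: "A *\<^sub>v v = A *\<^sub>v w"
  shows "v = w"
proof -
  note Ad = adj_mat[OF A]
  have *: "adj_mat A *\<^sub>v (A *\<^sub>v x) = det A \<cdot>\<^sub>v x" if "x \<in> carrier_vec n" for x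
    using Ad A that by (simp add: assoc_mult_mat_vec[symmetric, of _ n n _ n] smult_mat_mult_vec[of _ n n] del: assoc_mult_mat_vec)
  have "det A \<cdot>\<^sub>v v = det A \<cdot>\<^sub>v w" using *[OF v] *[OF w] eq by simp
  then show ?thesis using d v w by (auto simp: vec_eq_iff)
qed

text \<open>The all-one vector is cyclic for \<open>S\<close> over the rationals because
  \<open>W\<close> is nonsingular, so a matrix commuting with \<open>S\<close> is determined by its
  value there.\<close>

lemma commuting_eq_of_mult_ones:
  fixes X Y :: "int mat"
  assumes S: "S \<in> carrier_mat n n" and X: "X \<in> carrier_mat n n" and Y: "Y \<in> carrier_mat n n"
    and SX: "S * X = X * S" and SY: "S * Y = Y * S" and d: "det (walk_mat n S) \<noteq> 0"
    and e: "X *\<^sub>v ones_vec n = Y *\<^sub>v ones_vec n"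
  shows "X = Y"
proof -
  let ?W = "walk_mat n S"
  note Ad = adj_mat[OF walk_mat_carrier[of n S]]
  have w: "X *\<^sub>v walk n S j = Y *\<^sub>v walk n S j" for j
  proof (induction j)
    case 0
    then show ?case using e S by (simp add: walk_0)
  next
    case (Suc j)
    have *: "Z *\<^sub>v walk n S (Suc j) = S *\<^sub>v (Z *\<^sub>v walk n S j)"
      if "Z \<in> carrier_mat n n" "S * Z = Z * S" for Z
      using that S by (simp add: walk_Suc assoc_mult_mat_vec[symmetric, of _ n n _ n] del: assoc_mult_mat_vec)
    show ?case using *[OF X SX] *[OF Y SY] Suc by simp
  qed
  have "col (X * ?W) j = col (Y * ?W) j" if "j < n" for j
    using that w[of j] X Y S by (simp add: col_mult2[of _ n n _ n] col_walk_mat)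
  then have "X * ?W = Y * ?W" using X Y by (intro mat_col_eqI) auto
  then have "X * (?W * adj_mat ?W) = Y * (?W * adj_mat ?W)"
    using X Y Ad(1) by (simp add: assoc_mult_mat[symmetric, of _ n n _ n _ n] del: assoc_mult_mat)
  then have "det ?W \<cdot>\<^sub>m X = det ?W \<cdot>\<^sub>m Y"
    unfolding Ad(2) using X Y by (simp add: mult_smult_distrib[of _ n n _ n])
  then show ?thesis using d X Y by (auto simp: mat_eq_iff)
qed

section \<open>Matrices \<open>f(S)\<close> for integer polynomials of degree below
  \<open>n\<close>, and the prime 2\<close>

definition poly_mat :: "nat \<Rightarrow> int vec \<Rightarrow> int mat \<Rightarrow> int mat" where
  "poly_mat n f S = mat n n (\<lambda>(a, b). \<Sum>j < n. f $ j * (S ^\<^sub>m j) $$ (a, b))"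

lemma poly_mat_carrier [simp]: "poly_mat n f S \<in> carrier_mat n n"
  by (simp add: poly_mat_def)

lemma poly_mat_commute:
  assumes S: "S \<in> carrier_mat n n"
  shows "S * poly_mat n f S = poly_mat n f S * S"
proof (rule eq_matI)
  fix a b assume "a < dim_row (poly_mat n f S * S)" "b < dim_col (poly_mat n f S * S)"
  then have ab: "a < n" "b < n" using S by (auto simp: poly_mat_def)
  have pow: "S ^\<^sub>m j \<in> carrier_mat n n" for j using S by simp
  have "(S * poly_mat n f S) $$ (a, b) = (\<Sum>k = 0..<n. S $$ (a, k) * (\<Sum>j < n. f $ j * (S ^\<^sub>m j) $$ (k, b)))"
    using S ab by (simp add: scalar_prod_def poly_mat_def)
  also have "\<dots> = (\<Sum>j < n. f $ j * (\<Sum>k = 0..<n. S $$ (a, k) * (S ^\<^sub>m j) $$ (k, b)))"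
    unfolding sum_distrib_left by (subst sum.swap) (simp add: ac_simps)
  also have "\<dots> = (\<Sum>j < n. f $ j * (S * S ^\<^sub>m j) $$ (a, b))"
    using S ab pow by (intro sum.cong) (simp_all add: scalar_prod_def)
  also have "\<dots> = (\<Sum>j < n. f $ j * (S ^\<^sub>m j * S) $$ (a, b))"
    by (simp only: pow_mat_commute[OF S])
  also have "\<dots> = (\<Sum>j < n. f $ j * (\<Sum>k = 0..<n. (S ^\<^sub>m j) $$ (a, k) * S $$ (k, b)))"
    using S ab pow by (intro sum.cong) (simp_all add: scalar_prod_def)
  also have "\<dots> = (\<Sum>k = 0..<n. (\<Sum>j < n. f $ j * (S ^\<^sub>m j) $$ (a, k)) * S $$ (k, b))"
    unfolding sum_distrib_left sum_distrib_right by (subst sum.swap) (simp add: ac_simps)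
  also have "\<dots> = (poly_mat n f S * S) $$ (a, b)"
    using S ab by (simp add: scalar_prod_def poly_mat_def)
  finally show "(S * poly_mat n f S) $$ (a, b) = (poly_mat n f S * S) $$ (a, b)" .
qed (use S in \<open>auto simp: poly_mat_def\<close>)

lemma poly_mat_mult_ones:
  assumes S: "S \<in> carrier_mat n n" and f: "f \<in> carrier_vec n"
  shows "poly_mat n f S *\<^sub>v ones_vec n = walk_mat n S *\<^sub>v f"
proof (rule eq_vecI)
  fix a assume "a < dim_vec (walk_mat n S *\<^sub>v f)"
  then have a: "a < n" by simp
  have pow: "S ^\<^sub>m j \<in> carrier_mat n n" for j using S by simp
  have "(poly_mat n f S *\<^sub>v ones_vec n) $ a = (\<Sum>b = 0..<n. \<Sum>j < n. f $ j * (S ^\<^sub>m j) $$ (a, b))"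
    using a by (simp add: scalar_prod_def poly_mat_def)
  also have "\<dots> = (\<Sum>j < n. f $ j * (\<Sum>b = 0..<n. (S ^\<^sub>m j) $$ (a, b)))"
    unfolding sum_distrib_left by (rule sum.swap)
  also have "\<dots> = (\<Sum>j < n. walk n S j $ a * f $ j)"
    using a pow S by (intro sum.cong) (simp_all add: walk_def scalar_prod_def)
  finally show "(poly_mat n f S *\<^sub>v ones_vec n) $ a = (walk_mat n S *\<^sub>v f) $ a"
    using walk_mat_mult_vec[OF f a] by simp
qed (simp add: poly_mat_def)

lemma pow_mat_transpose_skew:
  fixes S :: "int mat"
  assumes S: "S \<in> carrier_mat n n" and skew: "S\<^sup>T = - S"
  shows "(S ^\<^sub>m k)\<^sup>T = (-1) ^ k \<cdot>\<^sub>m S ^\<^sub>m k"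
proof (induction k)
  case 0
  then show ?case using S by auto
next
  case (Suc k)
  have pow: "S ^\<^sub>m k \<in> carrier_mat n n" using S by simp
  have "(S ^\<^sub>m Suc k)\<^sup>T = S\<^sup>T * (S ^\<^sub>m k)\<^sup>T"
    using S pow by (simp add: transpose_mult[of _ n n _ n])
  also have "\<dots> = - S * ((-1) ^ k \<cdot>\<^sub>m S ^\<^sub>m k)" unfolding Suc skew ..
  also have "\<dots> = (-1) ^ Suc k \<cdot>\<^sub>m (S * S ^\<^sub>m k)"
    using S pow by (intro eq_matI) (auto simp: scalar_prod_def sum_distrib_left sum_negf mult.left_commute)
  finally show ?case using pow_mat_commute[OF S] by simp
qed

text \<open>Transposition changes powers of \<open>S\<close> only by signs, which disappear modulo
  2. This later trades column sums of \<open>f(S)\<close> for row sums.\<close>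

lemma even_poly_mat_transpose:
  assumes S: "S \<in> carrier_mat n n" and skew: "S\<^sup>T = - S" and ab: "a < n" "b < n"
  shows "even (poly_mat n f S $$ (a, b) - poly_mat n f S $$ (b, a))"
proof -
  have "(S ^\<^sub>m j) $$ (b, a) = (-1) ^ j * (S ^\<^sub>m j) $$ (a, b)" for j
  proof -
    have pow: "S ^\<^sub>m j \<in> carrier_mat n n" using S by simp
    have "(S ^\<^sub>m j) $$ (b, a) = (S ^\<^sub>m j)\<^sup>T $$ (a, b)" using ab S by simp
    then show ?thesis unfolding pow_mat_transpose_skew[OF S skew] using ab S by simp
  qed
  then have "poly_mat n f S $$ (a, b) - poly_mat n f S $$ (b, a) =
      (\<Sum>j < n. f $ j * (1 - (-1) ^ j) * (S ^\<^sub>m j) $$ (a, b))"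
    using ab by (simp add: poly_mat_def sum_subtractf algebra_simps)
  also have "even \<dots>" by (intro dvd_sum) auto
  finally show ?thesis .
qed

text \<open>Up to an odd factor \<open>u = f(S) e\<close>. With \<open>Z = f(S)\<close>, isotropy mod 4 makes \<open>Z\<^sup>T Z\<close> an even matrix,
  and the diagonal of \<open>Z\<^sup>T Z\<close> has the parity of the column sums of \<open>Z\<close>, hence of \<open>Z e\<close>.\<close>
lemma even_of_walk_isotropic:
  assumes S: "S \<in> carrier_mat n n" and skew: "S\<^sup>T = - S"
    and det: "det (walk_mat n S) = 2 ^ (n div 2) * q" "odd q"
    and u: "u \<in> carrier_vec n" and Wu: "dvd_vec 2 ((walk_mat n S)\<^sup>T *\<^sub>v u)"
    and iso: "\<And>k. 4 dvd u \<bullet> (S ^\<^sub>m k *\<^sub>v u)"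
  shows "dvd_vec 2 u"
proof -
  define W where "W = walk_mat n S"
  have W: "W \<in> carrier_mat n n" by (simp add: W_def)
  have d0: "det W \<noteq> 0" using det by (auto simp: W_def)
  \<comment> \<open>Row \<open>i\<close> of the Gram matrix is divisible by \<open>\<epsilon> i\<close>, and these factors exhaust the power of 2 in its
    determinant, so the quotient \<open>H\<close> is invertible mod 2.\<close>
  define \<epsilon> :: "nat \<Rightarrow> int" where "\<epsilon> i = (if i = 0 \<and> odd n then 1 else 2)" for i
  have gram: "(W\<^sup>T * W) $$ (i, j) = walk n S i \<bullet> walk n S j" if "i < n" "j < n" for i j
    using that W S by (simp add: W_def col_walk_mat)
  \<comment> \<open>Only the corner entry of the Gram matrix, which is \<open>n\<close>, can be odd;
    this is why \<open>\<epsilon>\<close> treats row 0 separately for odd \<open>n\<close>.\<close>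
  have \<epsilon>_dvd: "\<epsilon> i dvd walk n S i \<bullet> walk n S j" for i j
  proof (cases "i + j = 0")
    case True
    have "walk_count n S 0 = int n" using S by (simp add: walk_count_def walk_0 scalar_prod_def)
    then show ?thesis using True walk_scalar_prod[OF S skew, of 0 0] by (auto simp: \<epsilon>_def)
  next
    case False
    then show ?thesis
      using walk_count_even[OF S skew, of "i + j"] walk_scalar_prod[OF S skew, of i j]
      by (auto simp: \<epsilon>_def)
  qed
  define H where "H = mat n n (\<lambda>(i, j). (walk n S i \<bullet> walk n S j) div \<epsilon> i)"
  have H: "H \<in> carrier_mat n n" by (simp add: H_def)
  have WW: "W\<^sup>T * W = mat n n (\<lambda>(i, j). \<epsilon> i * H $$ (i, j))"
    using W gram \<epsilon>_dvd by (intro eq_matI) (auto simp: H_def)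
  have "(\<Prod>i < n. \<epsilon> i) = 2 ^ (2 * (n div 2))"
  proof (cases "even n")
    case False
    then obtain k where n: "n = Suc (2 * k)" by (metis oddE Suc_eq_plus1)
    have "(\<Prod>i < n. \<epsilon> i) = (\<Prod>i < 2 * k. 2)"
      unfolding n by (subst prod.lessThan_Suc_shift) (simp add: \<epsilon>_def n)
    then show ?thesis by (simp add: n)
  qed (auto simp: \<epsilon>_def)
  then have "(det W)\<^sup>2 = 2 ^ (2 * (n div 2)) * det H"
    using det_scale_rows[OF H, of \<epsilon>] det_mult[of "W\<^sup>T" n W] W
    unfolding WW[symmetric] by (simp add: det_transpose power2_eq_square)
  then have "det H = q\<^sup>2"
    using det(1) by (simp add: W_def power_mult_distrib power_mult[symmetric] mult.commute)
  then have h: "odd (det H)" using det(2) by simp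
  note Ad = adj_mat[OF H]
  have scale: "(mat n n (\<lambda>(i, j). \<epsilon> i * H $$ (i, j)) *\<^sub>v g) $ i = \<epsilon> i * (H *\<^sub>v g) $ i"
    if "g \<in> carrier_vec n" "i < n" for g i
    using that H by (simp add: scalar_prod_def sum_distrib_left mult.assoc)
  \<comment> \<open>Divisibility of the rows of \<open>W\<^sup>T *\<^sub>v x\<close> by the factors
    \<open>\<epsilon> i\<close> suffices to place the odd multiple \<open>det H\<close> of
    \<open>x\<close> in the column lattice of \<open>W\<close>.\<close>
  have solve: "W *\<^sub>v (adj_mat H *\<^sub>v b) = det H \<cdot>\<^sub>v x"
    if x: "x \<in> carrier_vec n" and b: "b \<in> carrier_vec n"
      and bx: "\<And>i. i < n \<Longrightarrow> (W\<^sup>T *\<^sub>v x) $ i = \<epsilon> i * b $ i" for x b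
  proof -
    have Adb: "adj_mat H *\<^sub>v b \<in> carrier_vec n" using Ad(1) b by simp
    have "W\<^sup>T *\<^sub>v (W *\<^sub>v (adj_mat H *\<^sub>v b)) = W\<^sup>T *\<^sub>v (det H \<cdot>\<^sub>v x)"
    proof (rule eq_vecI)
      fix i assume "i < dim_vec (W\<^sup>T *\<^sub>v (det H \<cdot>\<^sub>v x))"
      then have i: "i < n" using W by simp
      have "H *\<^sub>v (adj_mat H *\<^sub>v b) = det H \<cdot>\<^sub>v b"
        using Ad H b by (simp add: assoc_mult_mat_vec[symmetric, of _ n n _ n] smult_mat_mult_vec[of _ n n] del: assoc_mult_mat_vec)
      then have Hi: "(H *\<^sub>v (adj_mat H *\<^sub>v b)) $ i = det H * b $ i" using i b by simp
      have "(W\<^sup>T *\<^sub>v (W *\<^sub>v (adj_mat H *\<^sub>v b))) $ i = (W\<^sup>T * W *\<^sub>v (adj_mat H *\<^sub>v b)) $ i"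
        using W Adb by (simp add: assoc_mult_mat_vec[of _ n n _ n])
      also have "\<dots> = \<epsilon> i * (H *\<^sub>v (adj_mat H *\<^sub>v b)) $ i"
        unfolding WW using scale[OF Adb i] .
      also have "\<dots> = det H * (W\<^sup>T *\<^sub>v x) $ i" using Hi bx[OF i] by simp
      also have "\<dots> = (W\<^sup>T *\<^sub>v (det H \<cdot>\<^sub>v x)) $ i"
        using i W x by simp
      finally show "(W\<^sup>T *\<^sub>v (W *\<^sub>v (adj_mat H *\<^sub>v b))) $ i = (W\<^sup>T *\<^sub>v (det H \<cdot>\<^sub>v x)) $ i" .
    qed (use W in simp)
    then show ?thesis
      using mult_mat_vec_inj[of "W\<^sup>T" n "W *\<^sub>v (adj_mat H *\<^sub>v b)" "det H \<cdot>\<^sub>v x"] W Adb x d0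
      by (auto simp: det_transpose[OF W])
  qed
  have "(W\<^sup>T *\<^sub>v u) $ i = \<epsilon> i * (vec n (\<lambda>i. (W\<^sup>T *\<^sub>v u) $ i div \<epsilon> i)) $ i" if "i < n" for i
    using Wu that W by (auto simp: \<epsilon>_def dvd_vec_def W_def)
  from solve[OF u _ this]
  obtain f where f: "f \<in> carrier_vec n" "W *\<^sub>v f = det H \<cdot>\<^sub>v u"
    using Ad(1) by (metis mult_mat_vec_carrier vec_carrier)
  define Z where "Z = poly_mat n f S"
  have Z: "Z \<in> carrier_mat n n" by (simp add: Z_def)
  have SZ: "S * Z = Z * S" using poly_mat_commute[OF S] by (simp add: Z_def)
  have Ze: "Z *\<^sub>v ones_vec n = det H \<cdot>\<^sub>v u"
    using poly_mat_mult_ones[OF S f(1)] f(2) by (simp add: Z_def W_def)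
  have "(S * Z)\<^sup>T = (Z * S)\<^sup>T" using SZ by simp
  then have "Z\<^sup>T * - S = - S * Z\<^sup>T"
    using S Z by (simp add: transpose_mult[of _ n n _ n] skew)
  then have SZt: "S * Z\<^sup>T = Z\<^sup>T * S" using S Z by simp
  define x where "x = Z\<^sup>T *\<^sub>v (Z *\<^sub>v ones_vec n)"
  have x: "x \<in> carrier_vec n" unfolding x_def using Z by (intro mult_mat_vec_carrier[of _ n n]) auto
  have Zw: "Z *\<^sub>v walk n S i = det H \<cdot>\<^sub>v (S ^\<^sub>m i *\<^sub>v u)" for i
  proof (induction i)
    case 0
    then show ?case using Ze S u by (simp add: walk_0)
  next
    case (Suc i)
    have pow: "S ^\<^sub>m i \<in> carrier_mat n n" using S by simp
    have "Z *\<^sub>v walk n S (Suc i) = S *\<^sub>v (Z *\<^sub>v walk n S i)"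
      using S Z SZ by (simp add: walk_Suc assoc_mult_mat_vec[symmetric, of _ n n _ n] del: assoc_mult_mat_vec)
    also have "\<dots> = det H \<cdot>\<^sub>v (S * S ^\<^sub>m i *\<^sub>v u)"
      unfolding Suc using mult_mat_smult_vec[OF S mult_mat_vec_carrier[OF pow u]] assoc_mult_mat_vec[OF S pow u]
      by simp
    finally show ?case by (simp add: pow_mat_commute[OF S])
  qed
  have Wx: "4 dvd (W\<^sup>T *\<^sub>v x) $ i" if i: "i < n" for i
  proof -
    have Suc: "S ^\<^sub>m i *\<^sub>v u \<in> carrier_vec n" using S u by (intro mult_mat_vec_carrier[of _ n n]) auto
    have "(W\<^sup>T *\<^sub>v x) $ i = walk n S i \<bullet> (Z\<^sup>T *\<^sub>v (Z *\<^sub>v ones_vec n))"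
      using i W S by (simp add: x_def W_def col_walk_mat)
    also have "\<dots> = (Z *\<^sub>v walk n S i) \<bullet> (Z *\<^sub>v ones_vec n)"
      using transpose_vec_mult_scalar[of "Z\<^sup>T" n n "Z *\<^sub>v ones_vec n" "walk n S i"] Z S Ze u by simp
    also have "\<dots> = det H * (det H * (u \<bullet> (S ^\<^sub>m i *\<^sub>v u)))"
      unfolding Zw Ze using Suc u comm_scalar_prod[OF Suc u] by simp
    finally show ?thesis using iso by simp
  qed
  \<comment> \<open>Isotropy modulo 4 leaves a factor 2 after \<open>\<epsilon> i\<close> is
    removed; it becomes the evenness of \<open>Z\<^sup>T * Z\<close>.\<close>
  define b where "b = vec n (\<lambda>i. (W\<^sup>T *\<^sub>v x) $ i div (2 * \<epsilon> i))"
  have b: "b \<in> carrier_vec n" by (simp add: b_def)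
  have "(W\<^sup>T *\<^sub>v x) $ i = \<epsilon> i * (2 \<cdot>\<^sub>v b) $ i" if i: "i < n" for i
  proof -
    have "2 * \<epsilon> i dvd (W\<^sup>T *\<^sub>v x) $ i"
      using Wx[OF i] by (auto simp: \<epsilon>_def intro: dvd_trans[of 2 4])
    then show ?thesis using i by (auto simp: b_def)
  qed
  from solve[OF x _ this]
  have "W *\<^sub>v (2 \<cdot>\<^sub>v (adj_mat H *\<^sub>v b)) = det H \<cdot>\<^sub>v x"
    using b Ad(1) by (simp add: mult_mat_smult_vec[of _ n n])
  moreover define w where "w = adj_mat H *\<^sub>v b"
  ultimately have w: "w \<in> carrier_vec n" "2 \<cdot>\<^sub>v (W *\<^sub>v w) = det H \<cdot>\<^sub>v x"
    using Ad(1) b W by (auto simp: mult_mat_smult_vec[of _ n n])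
  define Y where "Y = poly_mat n w S"
  have Y: "Y \<in> carrier_mat n n" by (simp add: Y_def)
  have SY: "S * Y = Y * S" using poly_mat_commute[OF S] by (simp add: Y_def)
  have ZZ: "Z\<^sup>T * Z \<in> carrier_mat n n" using Z by simp
  have SZZ: "S * (Z\<^sup>T * Z) = Z\<^sup>T * Z * S"
  proof -
    have "S * (Z\<^sup>T * Z) = S * Z\<^sup>T * Z" using S Z by (simp add: assoc_mult_mat[of _ n n _ n _ n])
    also have "\<dots> = Z\<^sup>T * (S * Z)" unfolding SZt using S Z by (simp add: assoc_mult_mat[of _ n n _ n _ n])
    also have "\<dots> = Z\<^sup>T * Z * S" unfolding SZ using S Z by (simp add: assoc_mult_mat[of _ n n _ n _ n])
    finally show ?thesis .
  qed
  \<comment> \<open>Both sides commute with \<open>S\<close> and agree on the all-one vector, by the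
    choice of \<open>w\<close>.\<close>
  have "det H \<cdot>\<^sub>m (Z\<^sup>T * Z) = 2 \<cdot>\<^sub>m Y"
  proof (rule commuting_eq_of_mult_ones[OF S])
    show "S * (det H \<cdot>\<^sub>m (Z\<^sup>T * Z)) = det H \<cdot>\<^sub>m (Z\<^sup>T * Z) * S"
      using mult_smult_distrib[OF S ZZ] mult_smult_assoc_mat[OF ZZ S] SZZ by simp
    show "S * (2 \<cdot>\<^sub>m Y) = 2 \<cdot>\<^sub>m Y * S"
      using mult_smult_distrib[OF S Y] mult_smult_assoc_mat[OF Y S] SY by simp
    have "det H \<cdot>\<^sub>m (Z\<^sup>T * Z) *\<^sub>v ones_vec n = det H \<cdot>\<^sub>v x"
      using Z ZZ by (simp add: smult_mat_mult_vec[of _ n n] x_def assoc_mult_mat_vec[of _ n n _ n])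
    also have "\<dots> = 2 \<cdot>\<^sub>m Y *\<^sub>v ones_vec n"
      using Y w poly_mat_mult_ones[OF S w(1)] by (simp add: smult_mat_mult_vec[of _ n n] Y_def W_def)
    finally show "det H \<cdot>\<^sub>m (Z\<^sup>T * Z) *\<^sub>v ones_vec n = 2 \<cdot>\<^sub>m Y *\<^sub>v ones_vec n" .
  qed (use ZZ Y d0 in \<open>auto simp: W_def\<close>)
  then have diag: "det H * (Z\<^sup>T * Z) $$ (i, i) = 2 * Y $$ (i, i)" if "i < n" for i
    using that ZZ Y by (metis carrier_matD index_smult_mat(1))
  have "even (u $ i)" if i: "i < n" for i
  proof -
    have "even (det H * (Z\<^sup>T * Z) $$ (i, i))" unfolding diag[OF i] by simp
    then have "even (col Z i \<bullet> col Z i)" using h i Z by simp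
    then have "even (\<Sum>a = 0..<n. Z $$ (a, i))"
      unfolding even_scalar_prod_self using i Z by (simp add: scalar_prod_def)
    moreover have "even (\<Sum>a = 0..<n. Z $$ (i, a) - Z $$ (a, i))"
      using even_poly_mat_transpose[OF S skew i] by (intro dvd_sum) (auto simp: Z_def)
    ultimately have "even (\<Sum>a = 0..<n. Z $$ (i, a))" by (simp add: sum_subtractf)
    then have "even ((Z *\<^sub>v ones_vec n) $ i)" using i Z by (simp add: scalar_prod_def)
    then show ?thesis unfolding Ze using i u h by simp
  qed
  then show ?thesis using u by (auto simp: dvd_vec_def)
qed

subsection \<open>Generalized cospectrality and walk counts\<close>

text \<open>The matrix determinant lemma in adjugate form. The bordered matrix \<open>X\<close> is
  eliminated twice: \<open>Y1\<close> clears its top border and leaves the rank-one update,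
  \<open>Y2\<close> clears its left border and leaves the right-hand side times
  \<open>det A\<close>, which cancels against \<open>det Y2\<close>.\<close>

lemma det_add_rank_one:
  fixes A :: "'a::idom mat"
  assumes A: "A \<in> carrier_mat n n" and u: "u \<in> carrier_vec n" and v: "v \<in> carrier_vec n"
    and d: "det A \<noteq> 0"
  shows "det (mat n n (\<lambda>(i, j). A $$ (i, j) + u $ i * v $ j)) = det A + v \<bullet> (adj_mat A *\<^sub>v u)"
proof -
  define R where "R = mat 1 n (\<lambda>(i, j). v $ j)"
  define C where "C = mat n 1 (\<lambda>(i, j). u $ i)"
  define K where "K = mat n 1 (\<lambda>(i, j). - (adj_mat A *\<^sub>v u) $ i)"
  define X where "X = four_block_mat (1\<^sub>m 1) (- R) C A"
  note Ad = adj_mat[OF A]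
  have [simp]: "R \<in> carrier_mat 1 n" "C \<in> carrier_mat n 1" "K \<in> carrier_mat n 1"
    by (auto simp: R_def C_def K_def)
  note [simp] = this[unfolded One_nat_def]
  have X: "X \<in> carrier_mat (1 + n) (1 + n)" unfolding X_def using A by (intro four_block_carrier_mat) auto
  define B where "B = mat n n (\<lambda>(i, j). A $$ (i, j) + u $ i * v $ j)"
  define Y1 where "Y1 = four_block_mat (1\<^sub>m 1) R (0\<^sub>m n 1) (1\<^sub>m n)"
  have Y1: "Y1 \<in> carrier_mat (1 + n) (1 + n)" unfolding Y1_def by (intro four_block_carrier_mat) auto
  have "X * Y1 = four_block_mat (1\<^sub>m 1) (0\<^sub>m 1 n) C B"
    unfolding X_def Y1_def
    by (subst mult_four_block_mat[of _ 1 1 _ n _ n _ _ 1 _ n], insert A,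
        auto intro!: cong_four_block_mat eq_matI simp: B_def C_def R_def scalar_prod_def)
  moreover have "det Y1 = 1"
    unfolding Y1_def by (subst det_four_block_mat_lower_left_zero[of _ 1 _ n]) auto
  moreover have "det (four_block_mat (1\<^sub>m 1) (0\<^sub>m 1 n) C B) = det B"
    by (subst det_four_block_mat_upper_right_zero[of _ 1 _ n]) (auto simp: B_def)
  ultimately have 1: "det X = det B" using det_mult[OF X Y1] by simp
  define Y2 where "Y2 = four_block_mat (det A \<cdot>\<^sub>m 1\<^sub>m 1) (0\<^sub>m 1 n) K (1\<^sub>m n)"
  have Y2: "Y2 \<in> carrier_mat (1 + n) (1 + n)" unfolding Y2_def by (intro four_block_carrier_mat) auto
  define t where "t = det A + v \<bullet> (adj_mat A *\<^sub>v u)"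
  have AK: "A *\<^sub>v (adj_mat A *\<^sub>v u) = det A \<cdot>\<^sub>v u"
    using Ad A u by (simp add: assoc_mult_mat_vec[symmetric, of _ n n _ n] smult_mat_mult_vec[of _ n n]
        del: assoc_mult_mat_vec)
  have e1: "1\<^sub>m 1 * (det A \<cdot>\<^sub>m 1\<^sub>m 1) + - R * K = t \<cdot>\<^sub>m 1\<^sub>m 1"
    using Ad(1) v by (intro eq_matI) (auto simp: R_def K_def t_def scalar_prod_def sum_negf)
  have e2: "C * (det A \<cdot>\<^sub>m 1\<^sub>m 1) + A * K = 0\<^sub>m n 1"
  proof (rule eq_matI)
    fix i j assume "i < dim_row (0\<^sub>m n 1 :: 'a mat)" "j < dim_col (0\<^sub>m n 1 :: 'a mat)"
    then have ij: "i < n" "j = 0" by auto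
    have "col K 0 = - (adj_mat A *\<^sub>v u)" using Ad(1) by (intro eq_vecI) (auto simp: K_def)
    then have "(A * K) $$ (i, 0) = - (A *\<^sub>v (adj_mat A *\<^sub>v u)) $ i"
      using ij A Ad(1) by (simp add: K_def)
    then have "(A * K) $$ (i, 0) = - (det A * u $ i)" unfolding AK using ij u by simp
    then show "(C * (det A \<cdot>\<^sub>m 1\<^sub>m 1) + A * K) $$ (i, j) = 0\<^sub>m n 1 $$ (i, j)"
      using ij A by (simp add: C_def K_def scalar_prod_def)
  qed (use A in \<open>auto simp: C_def K_def\<close>)
  have e3: "1\<^sub>m 1 * 0\<^sub>m 1 n + - R * 1\<^sub>m n = - R"
    by (intro eq_matI) (auto simp: R_def)
  have e4: "C * 0\<^sub>m 1 n + A * 1\<^sub>m n = A"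
    using A by (intro eq_matI) (auto simp: C_def)
  have "X * Y2 = four_block_mat (1\<^sub>m 1 * (det A \<cdot>\<^sub>m 1\<^sub>m 1) + - R * K) (1\<^sub>m 1 * 0\<^sub>m 1 n + - R * 1\<^sub>m n)
      (C * (det A \<cdot>\<^sub>m 1\<^sub>m 1) + A * K) (C * 0\<^sub>m 1 n + A * 1\<^sub>m n)"
    unfolding X_def Y2_def using A by (intro mult_four_block_mat[of _ 1 1 _ n _ n _ _ 1 _ n]) auto
  then have "X * Y2 = four_block_mat (t \<cdot>\<^sub>m 1\<^sub>m 1) (- R) (0\<^sub>m n 1) A"
    unfolding e1 e2 e3 e4 .
  moreover have "det Y2 = det A"
    unfolding Y2_def by (subst det_four_block_mat_upper_right_zero[of _ 1 _ n]) auto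
  moreover have "det (four_block_mat (t \<cdot>\<^sub>m 1\<^sub>m 1) (- R) (0\<^sub>m n 1) A) = t * det A"
    using A by (subst det_four_block_mat_lower_left_zero[of _ 1 _ n]) auto
  ultimately have "det X * det A = t * det A" using det_mult[OF X Y2] by metis
  then show ?thesis using 1 d by (simp add: B_def t_def)
qed

text \<open>Over the rationals the pencil has determinant \<open>b ^ n\<close> times the
  characteristic polynomial at \<open>a / b\<close>.\<close>

lemma det_pencil_eq_of_char_poly_eq:
  fixes X Y :: "int mat"
  assumes X: "X \<in> carrier_mat n n" and Y: "Y \<in> carrier_mat n n"
    and eq: "char_poly X = char_poly Y" and b: "b \<noteq> 0"
  shows "det (a \<cdot>\<^sub>m 1\<^sub>m n - b \<cdot>\<^sub>m X) = det (a \<cdot>\<^sub>m 1\<^sub>m n - b \<cdot>\<^sub>m Y)"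
proof -
  have *: "rat_of_int (det (a \<cdot>\<^sub>m 1\<^sub>m n - b \<cdot>\<^sub>m Z)) =
      rat_of_int b ^ n * poly (map_poly rat_of_int (char_poly Z)) (rat_of_int a / rat_of_int b)"
    if Z: "Z \<in> carrier_mat n n" for Z :: "int mat"
  proof -
    define c where "c = rat_of_int a / rat_of_int b"
    let ?Z = "map_mat rat_of_int Z"
    have "map_mat rat_of_int (a \<cdot>\<^sub>m 1\<^sub>m n - b \<cdot>\<^sub>m Z) = rat_of_int b \<cdot>\<^sub>m (c \<cdot>\<^sub>m 1\<^sub>m n - ?Z)"
      using Z b by (intro eq_matI) (auto simp: c_def field_simps)
    then have "rat_of_int (det (a \<cdot>\<^sub>m 1\<^sub>m n - b \<cdot>\<^sub>m Z)) = rat_of_int b ^ n * det (c \<cdot>\<^sub>m 1\<^sub>m n - ?Z)"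
      using Z by (simp add: of_int_hom.hom_det[symmetric])
    also have "det (c \<cdot>\<^sub>m 1\<^sub>m n - ?Z) = poly (char_poly ?Z) c"
      unfolding char_poly_def using Z
      by (intro poly_det_cong[of _ n, symmetric]) (auto simp: char_poly_matrix_def)
    finally show ?thesis unfolding of_int_hom.char_poly_hom[OF Z] c_def .
  qed
  show ?thesis using *[OF X] *[OF Y] eq by simp
qed

lemma smult_one: "(1 :: 'a::monoid_mult) \<cdot>\<^sub>m A = A"
  by (intro eq_matI) auto

text \<open>The matrix is the identity modulo \<open>y\<close>. For \<open>y \<ge> 2\<close> this
  makes the determinant nonzero and lets it be cancelled modulo \<open>y\<close>.\<close>

lemma det_one_minus_smult_mod:
  fixes S :: "int mat"
  assumes S: "S \<in> carrier_mat n n"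
  shows "y dvd det (1\<^sub>m n - y \<cdot>\<^sub>m S) - 1"
proof -
  define B where "B = 1\<^sub>m n - y \<cdot>\<^sub>m S"
  have B: "B \<in> carrier_mat n n" using S by (simp add: B_def minus_carrier_mat)
  have "[B $$ (i, j) = 1\<^sub>m n $$ (i, j)] (mod y)" if "i < n" "j < n" for i j
    using that S by (auto simp: B_def cong_iff_dvd_diff)
  moreover have "\<pi> i < n" if "\<pi> permutes {0..<n}" "i < n" for \<pi> i
    using that permutes_in_image by fastforce
  ultimately have "[det B = det (1\<^sub>m n)] (mod y)"
    unfolding det_def'[OF B] det_def'[OF one_carrier_mat]
    by (intro cong_sum cong_mult cong_prod cong_refl) auto
  then have "[det (1\<^sub>m n - y \<cdot>\<^sub>m S) = det (1\<^sub>m n)] (mod y)" unfolding B_def .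
  then show ?thesis by (simp add: cong_iff_dvd_diff)
qed

text \<open>Obtained by applying the adjugate to \<open>(I - y S) w = w - y S w\<close> for a walk
  vector \<open>w\<close>: a denominator-free step in the expansion of the resolvent.\<close>

lemma resolvent_walk_recurrence:
  fixes S :: "int mat"
  assumes S: "S \<in> carrier_mat n n"
  shows "det (1\<^sub>m n - y \<cdot>\<^sub>m S) * walk_count n S i =
    ones_vec n \<bullet> (adj_mat (1\<^sub>m n - y \<cdot>\<^sub>m S) *\<^sub>v walk n S i) -
    y * (ones_vec n \<bullet> (adj_mat (1\<^sub>m n - y \<cdot>\<^sub>m S) *\<^sub>v walk n S (Suc i)))"
proof -
  define B where "B = 1\<^sub>m n - y \<cdot>\<^sub>m S"
  have B: "B \<in> carrier_mat n n" using S by (simp add: B_def minus_carrier_mat)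
  note Ad = adj_mat[OF B]
  let ?w = "walk n S i"
  have w: "?w \<in> carrier_vec n" "walk n S (Suc i) \<in> carrier_vec n" using S by auto
  have "B *\<^sub>v ?w = ?w - y \<cdot>\<^sub>v walk n S (Suc i)"
    unfolding B_def walk_Suc[OF S] using S w
    by (subst minus_mult_distrib_mat_vec[of _ n n]) (auto simp: smult_mat_mult_vec[of _ n n])
  then have "det B \<cdot>\<^sub>v ?w = adj_mat B *\<^sub>v (?w - y \<cdot>\<^sub>v walk n S (Suc i))"
    using assoc_mult_mat_vec[OF Ad(1) B w(1)] w(1) unfolding Ad(3)
    by (simp add: smult_mat_mult_vec[of _ n n])
  also have "\<dots> = adj_mat B *\<^sub>v ?w - y \<cdot>\<^sub>v (adj_mat B *\<^sub>v walk n S (Suc i))"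
    using Ad(1) w by (subst mult_minus_distrib_mat_vec[of _ n n]) (auto simp: mult_mat_smult_vec[of _ n n])
  finally have "ones_vec n \<bullet> (det B \<cdot>\<^sub>v ?w) =
      ones_vec n \<bullet> (adj_mat B *\<^sub>v ?w - y \<cdot>\<^sub>v (adj_mat B *\<^sub>v walk n S (Suc i)))" by simp
  also have "\<dots> = ones_vec n \<bullet> (adj_mat B *\<^sub>v ?w) - y * (ones_vec n \<bullet> (adj_mat B *\<^sub>v walk n S (Suc i)))"
    using Ad(1) w by (subst scalar_prod_minus_distrib[of _ n]) auto
  finally show ?thesis using w by (simp add: B_def walk_count_def)
qed

text \<open>The characteristic polynomials determine \<open>D = det(I - y S)\<close> and \<open>e\<^sup>T adj(I - y S) e\<close> for all integers
  \<open>y\<close>. As \<open>D\<close> is 1 mod \<open>y\<close>, the recurrence then determines each walk count modulo every large \<open>y\<close>.\<close>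
lemma walk_count_eq_of_char_poly_eq:
  fixes S T :: "int mat"
  assumes S: "S \<in> carrier_mat n n" and T: "T \<in> carrier_mat n n"
    and eq1: "char_poly S = char_poly T"
    and eq2: "char_poly (ones_mat n - 1\<^sub>m n - S) = char_poly (ones_mat n - 1\<^sub>m n - T)"
  shows "walk_count n S k = walk_count n T k"
proof -
  define D where "D X y = 1\<^sub>m n - y \<cdot>\<^sub>m X" for X :: "int mat" and y
  define \<alpha> where "\<alpha> X y i = ones_vec n \<bullet> (adj_mat (D X y) *\<^sub>v walk n X i)" for X y i
  have D: "D X y \<in> carrier_mat n n" if "X \<in> carrier_mat n n" for X y
    using that by (simp add: D_def minus_carrier_mat)
  have detD: "det (D S y) = det (D T y)" if "y \<ge> 2" for y
    using det_pencil_eq_of_char_poly_eq[OF S T eq1, of y 1] that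
    by (simp add: D_def smult_one)
  have D0: "det (D X y) \<noteq> 0" if "X \<in> carrier_mat n n" "y \<ge> 2" for X y
    using det_one_minus_smult_mod[OF that(1), of y] that(2) by (auto simp: D_def)
  \<comment> \<open>This pencil of \<open>J - I - X\<close> equals \<open>I - y X + y J\<close>, a
    rank-one update of \<open>D X y\<close>.\<close>
  have \<alpha>0: "y * \<alpha> X y 0 = det ((1 + y) \<cdot>\<^sub>m 1\<^sub>m n - (- y) \<cdot>\<^sub>m (ones_mat n - 1\<^sub>m n - X)) - det (D X y)"
    if X: "X \<in> carrier_mat n n" and y: "y \<ge> 2" for X y
  proof -
    note Ad = adj_mat(1)[OF D[OF X, of y]]
    have "(1 + y) \<cdot>\<^sub>m 1\<^sub>m n - (- y) \<cdot>\<^sub>m (ones_mat n - 1\<^sub>m n - X) =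
        mat n n (\<lambda>(i, j). D X y $$ (i, j) + (y \<cdot>\<^sub>v ones_vec n) $ i * ones_vec n $ j)"
      using X by (intro eq_matI) (auto simp: D_def ones_mat_def algebra_simps)
    also have "det \<dots> = det (D X y) + ones_vec n \<bullet> (adj_mat (D X y) *\<^sub>v (y \<cdot>\<^sub>v ones_vec n))"
      using D[OF X] D0[OF X y] by (intro det_add_rank_one) auto
    also have "\<dots> = det (D X y) + y * \<alpha> X y 0"
      using mult_mat_smult_vec[OF Ad ones_vec_carrier] X
        scalar_prod_smult_distrib[OF ones_vec_carrier mult_mat_vec_carrier[OF Ad ones_vec_carrier]]
      by (simp add: \<alpha>_def walk_0)
    finally show ?thesis by simp
  qed
  have K: "ones_mat n - 1\<^sub>m n - X \<in> carrier_mat n n" if "X \<in> carrier_mat n n" for X :: "int mat"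
    using that by (simp add: minus_carrier_mat)
  have "y * \<alpha> S y 0 = y * \<alpha> T y 0" if y: "y \<ge> 2" for y
    unfolding \<alpha>0[OF S y] \<alpha>0[OF T y] detD[OF y]
    using det_pencil_eq_of_char_poly_eq[OF K[OF S] K[OF T] eq2, of "- y" "1 + y"] y by simp
  then have base: "\<alpha> S y 0 = \<alpha> T y 0" if "y \<ge> 2" for y using that by force
  have rec: "det (D X y) * walk_count n X i = \<alpha> X y i - y * \<alpha> X y (Suc i)"
    if "X \<in> carrier_mat n n" for X y i
    using resolvent_walk_recurrence[OF that] by (simp add: D_def \<alpha>_def)
  have step: "walk_count n S i = walk_count n T i" if IH: "\<And>y. y \<ge> 2 \<Longrightarrow> \<alpha> S y i = \<alpha> T y i" for i
  proof (rule ccontr)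
    define c where "c = walk_count n S i - walk_count n T i"
    assume "walk_count n S i \<noteq> walk_count n T i"
    then have c: "c \<noteq> 0" by (simp add: c_def)
    \<comment> \<open>A modulus exceeding the absolute value of the nonzero \<open>c\<close> cannot
      divide it.\<close>
    define y where "y = \<bar>c\<bar> + 2"
    have y: "y \<ge> 2" by (simp add: y_def)
    have "det (D S y) * c = y * (\<alpha> T y (Suc i) - \<alpha> S y (Suc i))"
      using rec[OF S, of y i] rec[OF T, of y i] IH[OF y] detD[OF y]
      by (simp add: c_def algebra_simps)
    then have 1: "y dvd det (D S y) * c" by simp
    have "y dvd (det (D S y) - 1) * c"
      using det_one_minus_smult_mod[OF S, of y] by (simp add: D_def)
    from dvd_diff[OF 1 this] have "y dvd c" by (simp add: algebra_simps)
    then show False using c dvd_imp_le_int[of c y] by (simp add: y_def)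
  qed
  \<comment> \<open>Agreement at index \<open>k\<close> for all \<open>y\<close> gives equal walk
    counts at \<open>k\<close>; the recurrence, divided by \<open>y\<close>, then gives agreement at
    \<open>Suc k\<close>.\<close>
  have "\<forall>y \<ge> 2. \<alpha> S y k = \<alpha> T y k"
  proof (induction k)
    case 0
    then show ?case using base by blast
  next
    case (Suc k)
    show ?case
    proof (intro allI impI)
      fix y :: int assume y: "y \<ge> 2"
      have "y * \<alpha> S y (Suc k) = y * \<alpha> T y (Suc k)"
        using rec[OF S, of y k] rec[OF T, of y k] Suc y detD[OF y] step[of k] by simp
      then show "\<alpha> S y (Suc k) = \<alpha> T y (Suc k)" using y by simp
    qed
  qed
  then show ?thesis using step by blast
qed

subsection \<open>Levels of regular orthogonal matrices\<close>

abbreviation rat_mat :: "int mat \<Rightarrow> rat mat" where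
  "rat_mat \<equiv> map_mat rat_of_int"

text \<open>The product of the denominators of all entries is an admissible multiplier, so the
  minimum defining the level is attained.\<close>

lemma
  assumes Q: "Q \<in> carrier_mat n n"
  shows level_pos: "0 < level Q"
    and level_integral: "i < n \<Longrightarrow> j < n \<Longrightarrow> of_nat (level Q) * Q $$ (i, j) \<in> \<int>"
proof -
  define P where "P k \<longleftrightarrow> 0 < k \<and>
    (\<forall>i < dim_row Q. \<forall>j < dim_col Q. of_nat k * Q $$ (i, j) \<in> \<int>)" for k :: nat
  define den where "den q = nat (snd (quotient_of q))" for q :: rat
  have den: "0 < den q" "of_nat (den q) * q \<in> \<int>" for q
  proof -
    obtain a b where ab: "quotient_of q = (a, b)" by force
    have b: "b > 0" using quotient_of_denom_pos[OF ab] .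
    then show "0 < den q" by (simp add: den_def ab)
    have "rat_of_nat (den q) = of_int b" using b by (simp add: den_def ab)
    then have "of_nat (den q) * q = of_int a"
      using b quotient_of_div[OF ab] by simp
    then show "of_nat (den q) * q \<in> \<int>" by simp
  qed
  define I where "I = {0..<n} \<times> {0..<n}"
  have fin: "finite I" by (simp add: I_def)
  define k where "k = (\<Prod>x \<in> I. den (Q $$ x))"
  have "of_nat k * Q $$ x \<in> \<int>" if "x \<in> I" for x
  proof -
    have "of_nat k * Q $$ x = of_nat (\<Prod>y \<in> I - {x}. den (Q $$ y)) * (of_nat (den (Q $$ x)) * Q $$ x)"
      unfolding k_def by (subst prod.remove[OF fin that]) simp
    then show ?thesis using den(2) by (metis Ints_mult Ints_of_nat)
  qed
  moreover have "k > 0" unfolding k_def using den(1) by (intro prod_pos) simp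
  ultimately have "P k" using Q by (auto simp: P_def I_def)
  then have "P (level Q)" unfolding level_def P_def[symmetric] by (rule LeastI)
  then show "0 < level Q" "i < n \<Longrightarrow> j < n \<Longrightarrow> of_nat (level Q) * Q $$ (i, j) \<in> \<int>"
    using Q by (auto simp: P_def)
qed

text \<open>The remainder of an admissible multiplier modulo the level again clears the
  denominators, so by minimality it is zero.\<close>

lemma level_dvd:
  assumes Q: "Q \<in> carrier_mat n n"
    and k: "\<And>i j. i < n \<Longrightarrow> j < n \<Longrightarrow> of_nat k * Q $$ (i, j) \<in> \<int>"
  shows "level Q dvd k"
proof (rule ccontr)
  assume "\<not> ?thesis"
  then have r: "0 < k mod level Q" by (simp add: dvd_eq_mod_eq_0)
  have "of_nat (k mod level Q) * Q $$ (i, j) \<in> \<int>" if "i < n" "j < n" for i j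
  proof -
    have "k mod level Q + (k div level Q) * level Q = k" by simp
    then have "rat_of_nat k = of_nat (k mod level Q) + of_nat (k div level Q) * of_nat (level Q)"
      by (metis of_nat_add of_nat_mult)
    then have "of_nat (k mod level Q) * Q $$ (i, j) =
        of_nat k * Q $$ (i, j) - of_nat (k div level Q) * (of_nat (level Q) * Q $$ (i, j))"
      by (simp add: algebra_simps)
    then show ?thesis using k[OF that] level_integral[OF Q that]
      by (metis Ints_diff Ints_mult Ints_of_nat)
  qed
  then have "level Q \<le> k mod level Q"
    unfolding level_def[of Q] using r Q by (intro Least_le) (auto simp: level_def)
  moreover have "k mod level Q < level Q" using level_pos[OF Q] by simp
  ultimately show False by simp
qed

lemma level_transpose:
  assumes Q: "Q \<in> carrier_mat n n"
  shows "level Q\<^sup>T = level Q"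
proof -
  have *: "level P\<^sup>T dvd level P" if P: "P \<in> carrier_mat n n" for P
    using P level_integral[OF P] by (intro level_dvd[of _ n]) auto
  show ?thesis using *[OF Q] *[of "Q\<^sup>T"] Q by (simp add: dvd_antisym)
qed

lemma level_mult_dvd:
  assumes P: "P \<in> carrier_mat n n" and Q: "Q \<in> carrier_mat n n"
  shows "level (P * Q) dvd level P * level Q"
proof (rule level_dvd[of _ n])
  fix i j assume ij: "i < n" "j < n"
  have "of_nat (level P * level Q) * (P * Q) $$ (i, j) =
      (\<Sum>k = 0..<n. (of_nat (level P) * P $$ (i, k)) * (of_nat (level Q) * Q $$ (k, j)))"
    using P Q ij by (simp add: scalar_prod_def sum_distrib_left ac_simps)
  also have "\<dots> \<in> \<int>"
    using ij by (intro Ints_sum Ints_mult[OF level_integral[OF P] level_integral[OF Q]]) auto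
  finally show "of_nat (level P * level Q) * (P * Q) $$ (i, j) \<in> \<int>" .
qed (use P Q in simp)

lemma reg_rat_orthD:
  assumes "reg_rat_orth n Q"
  shows "Q \<in> carrier_mat n n" "Q\<^sup>T * Q = 1\<^sub>m n" "Q * Q\<^sup>T = 1\<^sub>m n"
    "Q *\<^sub>v ones_vec n = ones_vec n" "Q\<^sup>T *\<^sub>v ones_vec n = ones_vec n"
proof -
  show Q: "Q \<in> carrier_mat n n" "Q\<^sup>T * Q = 1\<^sub>m n" "Q *\<^sub>v ones_vec n = ones_vec n"
    using assms by (auto simp: reg_rat_orth_def)
  then show "Q * Q\<^sup>T = 1\<^sub>m n"
    using mat_mult_left_right_inverse[of "Q\<^sup>T" n Q] by simp
  have e: "(ones_vec n :: rat vec) \<in> carrier_vec n" by (simp add: ones_vec_def)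
  have "Q\<^sup>T *\<^sub>v ones_vec n = Q\<^sup>T *\<^sub>v (Q *\<^sub>v ones_vec n)" using Q by simp
  also have "\<dots> = Q\<^sup>T * Q *\<^sub>v ones_vec n"
    using assoc_mult_mat_vec[of "Q\<^sup>T" n n Q n, OF _ Q(1) e] Q(1) by simp
  finally show "Q\<^sup>T *\<^sub>v ones_vec n = ones_vec n" using Q(2) e by simp
qed

lemma reg_rat_orth_mult:
  assumes P: "reg_rat_orth n P" and Q: "reg_rat_orth n Q"
  shows "reg_rat_orth n (P * Q)"
proof -
  note P = reg_rat_orthD[OF P] and Q = reg_rat_orthD[OF Q]
  have e: "(ones_vec n :: rat vec) \<in> carrier_vec n" by (simp add: ones_vec_def)
  have "(P * Q)\<^sup>T * (P * Q) = Q\<^sup>T * (P\<^sup>T * P) * Q"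
    using P(1) Q(1) by (simp add: transpose_mult[of _ n n _ n] assoc_mult_mat[of _ n n _ n _ n])
  then have "(P * Q)\<^sup>T * (P * Q) = 1\<^sub>m n" using P(2) Q(1,2) by simp
  moreover have "P * Q *\<^sub>v ones_vec n = ones_vec n"
    using assoc_mult_mat_vec[OF P(1) Q(1) e] P(4) Q(4) by simp
  ultimately show ?thesis using P(1) Q(1) by (simp add: reg_rat_orth_def)
qed

lemma reg_rat_orth_transpose:
  assumes "reg_rat_orth n Q"
  shows "reg_rat_orth n Q\<^sup>T"
  using reg_rat_orthD(1,3,5)[OF assms] unfolding reg_rat_orth_def by simp

text \<open>Level 1 means integral entries, and an integral orthogonal matrix is a signed
  permutation matrix; regularity excludes the negative signs.\<close>

lemma is_perm_mat_of_level_1: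
  assumes orth: "reg_rat_orth n Q" and lev: "level Q = 1"
  shows "is_perm_mat n Q"
proof -
  note Q = reg_rat_orthD[OF orth]
  have int: "Q $$ (i, j) \<in> \<int>" if "i < n" "j < n" for i j
    using level_integral[OF Q(1) that] lev by simp
  \<comment> \<open>An integer is at most its square, so row sum 1 and square sum 1 make every entry idempotent.\<close>
  have idem: "Q $$ (i, j) = 0 \<or> Q $$ (i, j) = 1" if ij: "i < n" "j < n" for i j
  proof -
    have "(\<Sum>k = 0..<n. Q $$ (i, k) * Q $$ (i, k)) = (Q * Q\<^sup>T) $$ (i, i)"
      using ij Q(1) by (simp add: scalar_prod_def)
    moreover have "(\<Sum>k = 0..<n. Q $$ (i, k)) = (Q *\<^sub>v ones_vec n) $ i"
      using ij Q(1) by (simp add: scalar_prod_def ones_vec_def)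
    ultimately have "(\<Sum>k = 0..<n. Q $$ (i, k) * Q $$ (i, k) - Q $$ (i, k)) = 0"
      unfolding Q(3,4) using ij by (simp add: sum_subtractf ones_vec_def)
    moreover have "Q $$ (i, k) * Q $$ (i, k) - Q $$ (i, k) \<ge> 0" if k: "k < n" for k
    proof -
      obtain z where z: "Q $$ (i, k) = of_int z" using int[OF ij(1) k] by (auto elim: Ints_cases)
      have "z * (z - 1) \<ge> 0" by (cases "z \<ge> 1") (auto intro: mult_nonneg_nonneg mult_nonpos_nonpos)
      then have "z * z - z \<ge> 0" by (simp add: algebra_simps)
      then have "rat_of_int (z * z - z) \<ge> 0" by (simp only: of_int_0_le_iff)
      then show ?thesis unfolding z by simp
    qed
    ultimately have "Q $$ (i, j) * Q $$ (i, j) - Q $$ (i, j) = 0"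
      using ij by (subst (asm) sum_nonneg_eq_0_iff) auto
    then have "Q $$ (i, j) * (Q $$ (i, j) - 1) = 0" by (simp add: algebra_simps)
    then show ?thesis by simp
  qed
  have nonneg: "Q $$ (i, j) * Q $$ (i', j') \<ge> 0" if "i < n" "j < n" "i' < n" "j' < n" for i j i' j'
    using idem[of i j] idem[of i' j'] that by auto
  have colsum: "(\<Sum>k = 0..<n. Q $$ (k, j)) = 1" if "j < n" for j
  proof -
    have "(\<Sum>k = 0..<n. Q $$ (k, j)) = (Q\<^sup>T *\<^sub>v ones_vec n) $ j"
      using that Q(1) by (simp add: scalar_prod_def ones_vec_def)
    then show ?thesis unfolding Q(5) using that by (simp add: ones_vec_def)
  qed
  have ex: "\<exists>i < n. Q $$ (i, j) = 1" if "j < n" for j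
  proof (rule ccontr)
    assume "\<not> ?thesis"
    then have "(\<Sum>k = 0..<n. Q $$ (k, j)) = 0" using idem that
      by (intro sum.neutral ballI) (metis atLeastLessThan_iff)
    then show False using colsum[OF that] by simp
  qed
  have orthrow: "j = j'" if "i < n" "j < n" "j' < n" "Q $$ (i, j) = 1" "Q $$ (i, j') = 1" for i j j'
  proof (rule ccontr)
    assume "j \<noteq> j'"
    have "(\<Sum>k = 0..<n. Q $$ (k, j) * Q $$ (k, j')) = (Q\<^sup>T * Q) $$ (j, j')"
      using that Q(1) by (simp add: scalar_prod_def)
    also have "\<dots> = 0" unfolding Q(2) using that \<open>j \<noteq> j'\<close> by simp
    finally have "\<forall>k \<in> {0..<n}. Q $$ (k, j) * Q $$ (k, j') = 0"
      using that by (subst (asm) sum_nonneg_eq_0_iff) (auto intro: nonneg)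
    from bspec[OF this, of i] show False using that by simp
  qed
  have uniqcol: "i = i'" if "i < n" "i' < n" "j < n" "Q $$ (i, j) = 1" "Q $$ (i', j) = 1" for i i' j
  proof (rule ccontr)
    assume "i \<noteq> i'"
    have "(\<Sum>k = 0..<n. Q $$ (i, k) * Q $$ (i', k)) = (Q * Q\<^sup>T) $$ (i, i')"
      using that Q(1) by (simp add: scalar_prod_def)
    also have "\<dots> = 0" unfolding Q(3) using that \<open>i \<noteq> i'\<close> by simp
    finally have "\<forall>k \<in> {0..<n}. Q $$ (i, k) * Q $$ (i', k) = 0"
      using that by (subst (asm) sum_nonneg_eq_0_iff) (auto intro: nonneg)
    from bspec[OF this, of j] show False using that by simp
  qed
  \<comment> \<open>A permutation of \<open>{0..<n}\<close> has to fix every index outside it, hence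
    the default \<open>j\<close>.\<close>
  define p where "p j = (if j < n then SOME i. i < n \<and> Q $$ (i, j) = 1 else j)" for j
  have p: "p j < n" "Q $$ (p j, j) = 1" if "j < n" for j
    using someI_ex[of "\<lambda>i. i < n \<and> Q $$ (i, j) = 1"] ex[OF that] that by (auto simp: p_def)
  have "inj_on p {0..<n}" using p orthrow by (intro inj_onI) (metis atLeastLessThan_iff)
  moreover have "p ` {0..<n} \<subseteq> {0..<n}" using p by auto
  ultimately have "bij_betw p {0..<n} {0..<n}" by (simp add: bij_betw_def endo_inj_surj)
  then have "p permutes {0..<n}" by (rule bij_imp_permutes) (simp add: p_def)
  moreover have "Q = perm_mat n p"
  proof (rule eq_matI)
    fix i j assume "i < dim_row (perm_mat n p :: rat mat)" "j < dim_col (perm_mat n p :: rat mat)"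
    then have ij: "i < n" "j < n" by (auto simp: perm_mat_def)
    show "Q $$ (i, j) = perm_mat n p $$ (i, j)"
    proof (cases "i = p j")
      case True
      then show ?thesis using ij p(2)[OF ij(2)] by (simp add: perm_mat_def)
    next
      case False
      then have "Q $$ (i, j) = 0"
        using idem[OF ij] uniqcol[OF ij(1) p(1)[OF ij(2)] ij(2) _ p(2)[OF ij(2)]] by blast
      then show ?thesis using False ij by (simp add: perm_mat_def)
    qed
  qed (use Q(1) in \<open>auto simp: perm_mat_def\<close>)
  ultimately show ?thesis unfolding is_perm_mat_def by blast
qed

lemma og_isomorphic_of_rat:
  assumes P: "is_perm_mat n (P :: rat mat)"
    and eq: "P\<^sup>T * rat_mat (skew_adj n A) * P = rat_mat (skew_adj n B)"
  shows "og_isomorphic n A B"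
proof -
  obtain p where p: "p permutes {0..<n}" "P = perm_mat n p" using P by (auto simp: is_perm_mat_def)
  have P: "P = rat_mat (perm_mat n p)" unfolding p(2) by (intro eq_matI) (auto simp: perm_mat_def)
  have c: "(perm_mat n p :: int mat) \<in> carrier_mat n n" "skew_adj n A \<in> carrier_mat n n"
    by (auto simp: perm_mat_def skew_adj_def)
  have "rat_mat ((perm_mat n p)\<^sup>T * skew_adj n A * perm_mat n p) = rat_mat (skew_adj n B)"
    unfolding eq[symmetric] P using c
    by (simp add: of_int_hom.mat_hom_mult[of _ n n _ n] map_mat_transpose)
  then have "(perm_mat n p)\<^sup>T * skew_adj n A * perm_mat n p = skew_adj n B"
    by (rule of_int_hom.mat_hom_inj)
  then show ?thesis using p unfolding og_isomorphic_def is_perm_mat_def by blast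
qed

subsection \<open>Regular orthogonal intertwiners\<close>

lemma rat_mat_inj: "rat_mat X = rat_mat Y \<Longrightarrow> X = Y"
  by (rule of_int_hom.mat_hom_inj)

text \<open>The witness is \<open>W(S)\<close> times the inverse of \<open>W(T)\<close>. Equal Gram
  matrices make it orthogonal and give equal squared determinants, equal Gram matrices with
  \<open>S\<close> and \<open>T\<close> inserted give the conjugation, and the common first column
  of the walk matrices gives regularity.\<close>

lemma exists_intertwiner:
  fixes S T :: "int mat"
  assumes S: "S \<in> carrier_mat n n" and skS: "S\<^sup>T = - S"
    and T: "T \<in> carrier_mat n n" and skT: "T\<^sup>T = - T"
    and count: "\<And>k. walk_count n S k = walk_count n T k"
    and d: "det (walk_mat n S) \<noteq> 0"
  obtains Q where "reg_rat_orth n Q" and "Q\<^sup>T * rat_mat S * Q = rat_mat T"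
    and "(det (walk_mat n T))\<^sup>2 = (det (walk_mat n S))\<^sup>2"
proof -
  let ?A = "walk_mat n S" and ?B = "walk_mat n T"
  have gram: "?A\<^sup>T * ?A = ?B\<^sup>T * ?B"
    using S T walk_scalar_prod[OF S skS] walk_scalar_prod[OF T skT] count
    by (intro eq_matI) (auto simp: col_walk_mat)
  \<comment> \<open>Inserting the matrix raises the second walk index by one. The walk counts cover
    even the last column, where this index leaves the walk matrix.\<close>
  have gram1: "?A\<^sup>T * (S * ?A) = ?B\<^sup>T * (T * ?B)"
  proof (rule eq_matI)
    fix i j assume "i < dim_row (?B\<^sup>T * (T * ?B))" "j < dim_col (?B\<^sup>T * (T * ?B))"
    then have ij: "i < n" "j < n" by auto
    have *: "((walk_mat n X)\<^sup>T * (X * walk_mat n X)) $$ (i, j) = walk n X i \<bullet> walk n X (Suc j)"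
      if X: "X \<in> carrier_mat n n" for X
      using X ij by (simp add: col_walk_mat col_mult2[OF X walk_mat_carrier] walk_Suc)
    show "(?A\<^sup>T * (S * ?A)) $$ (i, j) = (?B\<^sup>T * (T * ?B)) $$ (i, j)"
      unfolding *[OF S] *[OF T] walk_scalar_prod[OF S skS] walk_scalar_prod[OF T skT] count ..
  qed auto
  have det: "(det ?B)\<^sup>2 = (det ?A)\<^sup>2"
    using arg_cong[OF gram, of det] det_mult[of "?A\<^sup>T" n ?A] det_mult[of "?B\<^sup>T" n ?B]
    by (simp add: det_transpose[of _ n] power2_eq_square)
  define a b where "a = rat_mat ?A" and "b = rat_mat ?B"
  have car [simp]: "a \<in> carrier_mat n n" "b \<in> carrier_mat n n" "a\<^sup>T \<in> carrier_mat n n" "b\<^sup>T \<in> carrier_mat n n"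
    by (auto simp: a_def b_def)
  have S': "rat_mat S \<in> carrier_mat n n" and T': "rat_mat T \<in> carrier_mat n n" using S T by auto
  have "det b \<noteq> 0" using det d by (auto simp: b_def of_int_hom.hom_det)
  define V where "V = (1 / det b) \<cdot>\<^sub>m adj_mat b"
  have V [simp]: "V \<in> carrier_mat n n" "V\<^sup>T \<in> carrier_mat n n"
    using adj_mat(1)[of b n] by (auto simp: V_def)
  have bV: "b * V = 1\<^sub>m n"
    using adj_mat[of b n] \<open>det b \<noteq> 0\<close> unfolding V_def
    by (simp add: mult_smult_distrib[of _ n n _ n]) (intro eq_matI, auto)
  then have Vb: "V * b = 1\<^sub>m n" using mat_mult_left_right_inverse[of b n V] by simp
  have VTbT: "V\<^sup>T * b\<^sup>T = 1\<^sub>m n"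
    using transpose_mult[of b n n V n] bV by simp
  define Q where "Q = a * V"
  have Q: "Q \<in> carrier_mat n n" unfolding Q_def by (rule mult_carrier_mat[of _ n n]) auto
  have QT: "Q\<^sup>T = V\<^sup>T * a\<^sup>T" unfolding Q_def by (rule transpose_mult[of _ n n _ n]) auto
  have gr: "a\<^sup>T * a = b\<^sup>T * b"
    using arg_cong[OF gram, of rat_mat]
    by (simp add: a_def b_def of_int_hom.mat_hom_mult[of _ n n _ n] map_mat_transpose)
  have gr1: "a\<^sup>T * (rat_mat S * a) = b\<^sup>T * (rat_mat T * b)"
    using arg_cong[OF gram1, of rat_mat] S T
    by (simp add: a_def b_def of_int_hom.mat_hom_mult[of _ n n _ n] map_mat_transpose)
  have conj: "V\<^sup>T * (b\<^sup>T * (X * b)) * V = X" if X: "X \<in> carrier_mat n n" for X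
  proof -
    have "V\<^sup>T * (b\<^sup>T * (X * b)) * V = (V\<^sup>T * b\<^sup>T) * (X * (b * V))"
      using X by (simp add: assoc_mult_mat[of _ n n _ n _ n] mult_carrier_mat[of _ n n _ n])
    then show ?thesis using X bV VTbT by simp
  qed
  have "Q\<^sup>T * Q = V\<^sup>T * (a\<^sup>T * a) * V"
    unfolding QT unfolding Q_def by (simp add: assoc_mult_mat[of _ n n _ n _ n] mult_carrier_mat[of _ n n _ n])
  then have orth: "Q\<^sup>T * Q = 1\<^sub>m n"
    unfolding gr using conj[of "1\<^sub>m n"] left_mult_one_mat[of b n n] by simp
  have "Q\<^sup>T * rat_mat S * Q = V\<^sup>T * (a\<^sup>T * (rat_mat S * a)) * V"
    unfolding QT unfolding Q_def using S' by (simp add: assoc_mult_mat[of _ n n _ n _ n] mult_carrier_mat[of _ n n _ n])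
  then have inter: "Q\<^sup>T * rat_mat S * Q = rat_mat T"
    unfolding gr1 using conj[OF T'] by simp
  have Qb: "Q * b = a"
    using Vb right_mult_one_mat[OF car(1)] by (simp add: Q_def assoc_mult_mat[of _ n n _ n _ n] mult_carrier_mat[of _ n n _ n])
  have "Q *\<^sub>v ones_vec n = ones_vec n"
  proof (cases "n = 0")
    case True
    then show ?thesis using Q by (intro eq_vecI) (auto simp: ones_vec_def)
  next
    case False
    then have "col b 0 = ones_vec n" "col a 0 = ones_vec n"
      using S T by (auto simp: a_def b_def col_walk_mat walk_0 ones_vec_def intro!: eq_vecI)
    moreover have "col (Q * b) 0 = Q *\<^sub>v col b 0"
      using False Q by (intro col_mult2[of _ n n _ n]) auto
    ultimately show ?thesis using Qb by simp
  qed
  then show ?thesis using that[of Q] Q orth inter det by (simp add: reg_rat_orth_def)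
qed

lemma intertwiner_walk:
  assumes orth: "reg_rat_orth n Q" and S: "S \<in> carrier_mat n n" and T: "T \<in> carrier_mat n n"
    and eq: "Q\<^sup>T * rat_mat S * Q = rat_mat T"
  shows "rat_mat S * Q = Q * rat_mat T" and "Q\<^sup>T * rat_mat (walk_mat n S) = rat_mat (walk_mat n T)"
proof -
  note Q = reg_rat_orthD[OF orth]
  have QT: "Q\<^sup>T \<in> carrier_mat n n" using Q(1) by simp
  have S': "rat_mat S \<in> carrier_mat n n" and T': "rat_mat T \<in> carrier_mat n n" using S T by auto
  have "Q * rat_mat T = (Q * Q\<^sup>T) * (rat_mat S * Q)"
    unfolding eq[symmetric] using Q(1) QT S' by (simp add: assoc_mult_mat[of _ n n _ n _ n] mult_carrier_mat[of _ n n _ n])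
  then show "rat_mat S * Q = Q * rat_mat T" using Q(1,3) S' by simp
  have "rat_mat T * Q\<^sup>T = (Q\<^sup>T * rat_mat S) * (Q * Q\<^sup>T)"
    unfolding eq[symmetric] using Q(1) QT S' by (simp add: assoc_mult_mat[of _ n n _ n _ n] mult_carrier_mat[of _ n n _ n])
  then have TQ: "rat_mat T * Q\<^sup>T = Q\<^sup>T * rat_mat S" using QT Q(3) S' by simp
  let ?v = "map_vec rat_of_int"
  have w: "Q\<^sup>T *\<^sub>v ?v (walk n S k) = ?v (walk n T k)" for k
  proof (induction k)
    case 0
    have "?v (ones_vec n) = ones_vec n" by (intro eq_vecI) (auto simp: ones_vec_def)
    then show ?case using Q(5) S T by (simp add: walk_0)
  next
    case (Suc k)
    have c: "?v (walk n S k) \<in> carrier_vec n" using S by simp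
    have "Q\<^sup>T *\<^sub>v ?v (walk n S (Suc k)) = Q\<^sup>T *\<^sub>v (rat_mat S *\<^sub>v ?v (walk n S k))"
      unfolding walk_Suc[OF S] of_int_hom.mult_mat_vec_hom[OF S walk_carrier[OF S]] ..
    also have "\<dots> = rat_mat T *\<^sub>v (Q\<^sup>T *\<^sub>v ?v (walk n S k))"
      unfolding assoc_mult_mat_vec[OF QT S' c, symmetric] assoc_mult_mat_vec[OF T' QT c, symmetric] TQ ..
    also have "\<dots> = ?v (walk n T (Suc k))"
      unfolding Suc walk_Suc[OF T] of_int_hom.mult_mat_vec_hom[OF T walk_carrier[OF T]] ..
    finally show ?case .
  qed
  show "Q\<^sup>T * rat_mat (walk_mat n S) = rat_mat (walk_mat n T)"
  proof (rule mat_col_eqI)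
    fix j assume "j < dim_col (rat_mat (walk_mat n T))"
    then have j: "j < n" by simp
    have "col (Q\<^sup>T * rat_mat (walk_mat n S)) j = Q\<^sup>T *\<^sub>v col (rat_mat (walk_mat n S)) j"
      using QT j by (intro col_mult2[of _ n n _ n]) auto
    then show "col (Q\<^sup>T * rat_mat (walk_mat n S)) j = col (rat_mat (walk_mat n T)) j"
      using j S T w[of j] by (simp add: col_walk_mat)
  qed (use QT in auto)
qed

text \<open>Here \<open>M\<close> is \<open>Q\<close> cleared of denominators. The products with the
  walk matrices place its columns and rows in left kernels modulo each prime divisor of the level,
  and minimality of the level keeps \<open>M\<close> nonzero modulo such a prime.\<close>

lemma integral_intertwiner:
  assumes orth: "reg_rat_orth n Q" and S: "S \<in> carrier_mat n n" and T: "T \<in> carrier_mat n n"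
    and eq: "Q\<^sup>T * rat_mat S * Q = rat_mat T"
  obtains M where "M \<in> carrier_mat n n" and "S * M = M * T"
    and "M\<^sup>T * M = (int (level Q))\<^sup>2 \<cdot>\<^sub>m 1\<^sub>m n"
    and "(walk_mat n S)\<^sup>T * M = int (level Q) \<cdot>\<^sub>m (walk_mat n T)\<^sup>T"
    and "(walk_mat n T)\<^sup>T * M\<^sup>T = int (level Q) \<cdot>\<^sub>m (walk_mat n S)\<^sup>T"
    and "\<And>p. prime p \<Longrightarrow> p dvd int (level Q) \<Longrightarrow> \<exists>i < n. \<exists>j < n. \<not> p dvd M $$ (i, j)"
proof -
  note Q = reg_rat_orthD[OF orth]
  have QT: "Q\<^sup>T \<in> carrier_mat n n" using Q(1) by simp
  have S': "rat_mat S \<in> carrier_mat n n" and T': "rat_mat T \<in> carrier_mat n n" using S T by auto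
  let ?l = "rat_of_int (int (level Q))"
  \<comment> \<open>The floor is exact, the scaled entries being integers.\<close>
  define M where "M = mat n n (\<lambda>(i, j). \<lfloor>?l * Q $$ (i, j)\<rfloor>)"
  have M: "M \<in> carrier_mat n n" by (simp add: M_def)
  have Mij: "rat_of_int (M $$ (i, j)) = ?l * Q $$ (i, j)" if "i < n" "j < n" for i j
    using level_integral[OF Q(1) that] that by (auto simp: M_def elim!: Ints_cases)
  have rM: "rat_mat M = ?l \<cdot>\<^sub>m Q" using M Q(1) Mij by (intro eq_matI) auto
  have rMT: "rat_mat M\<^sup>T = ?l \<cdot>\<^sub>m Q\<^sup>T" using M Q(1) Mij by (intro eq_matI) auto
  have hm: "rat_mat (X * Y) = rat_mat X * rat_mat Y"
    if "X \<in> carrier_mat n n" "Y \<in> carrier_mat n n" for X Y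
    using that by (rule of_int_hom.mat_hom_mult)
  have hs: "rat_mat (c \<cdot>\<^sub>m X) = of_int c \<cdot>\<^sub>m rat_mat X" for c X by (intro eq_matI) auto
  note int = intertwiner_walk[OF orth S T eq]
  let ?A = "walk_mat n S" and ?B = "walk_mat n T"
  have WA: "rat_mat ?A \<in> carrier_mat n n" "rat_mat ?A\<^sup>T \<in> carrier_mat n n" by auto
  have WB: "rat_mat ?B \<in> carrier_mat n n" "rat_mat ?B\<^sup>T \<in> carrier_mat n n" by auto
  have "rat_mat (S * M) = rat_mat (M * T)"
    unfolding hm[OF S M] hm[OF M T] rM
    using int(1) mult_smult_distrib[OF S' Q(1)] mult_smult_assoc_mat[OF Q(1) T'] by simp
  then have SM: "S * M = M * T" by (rule rat_mat_inj)
  have "rat_mat (M\<^sup>T * M) = rat_mat ((int (level Q))\<^sup>2 \<cdot>\<^sub>m 1\<^sub>m n)"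
  proof -
    have "rat_mat (M\<^sup>T * M) = (?l \<cdot>\<^sub>m Q\<^sup>T) * (?l \<cdot>\<^sub>m Q)"
      using hm[of "M\<^sup>T" M] M rM rMT by simp
    also have "\<dots> = ?l \<cdot>\<^sub>m (?l \<cdot>\<^sub>m (Q\<^sup>T * Q))"
      using mult_smult_assoc_mat[OF QT, of "?l \<cdot>\<^sub>m Q" n ?l] mult_smult_distrib[OF QT Q(1), of ?l] Q(1)
      by simp
    also have "\<dots> = rat_mat ((int (level Q))\<^sup>2 \<cdot>\<^sub>m 1\<^sub>m n)"
      unfolding Q(2) by (intro eq_matI) (auto simp: power2_eq_square)
    finally show ?thesis .
  qed
  then have MM: "M\<^sup>T * M = (int (level Q))\<^sup>2 \<cdot>\<^sub>m 1\<^sub>m n" by (rule rat_mat_inj)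
  have AQ: "rat_mat ?A\<^sup>T * Q = rat_mat ?B\<^sup>T"
    using arg_cong[OF int(2), of transpose_mat] transpose_mult[OF QT WA(1)]
    by (simp add: map_mat_transpose)
  have "Q * rat_mat ?B = (Q * Q\<^sup>T) * rat_mat ?A"
    unfolding int(2)[symmetric] using assoc_mult_mat[OF Q(1) QT WA(1)] by simp
  then have "Q * rat_mat ?B = rat_mat ?A" using Q(3) WA by simp
  then have BQ: "rat_mat ?B\<^sup>T * Q\<^sup>T = rat_mat ?A\<^sup>T"
    using transpose_mult[OF Q(1) WB(1)] by (simp add: map_mat_transpose)
  have "rat_mat (?A\<^sup>T * M) = rat_mat (int (level Q) \<cdot>\<^sub>m ?B\<^sup>T)"
    using hm[of "?A\<^sup>T" M] M mult_smult_distrib[OF WA(2) Q(1), of ?l] AQ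
    by (simp add: rM hs)
  then have AM: "?A\<^sup>T * M = int (level Q) \<cdot>\<^sub>m ?B\<^sup>T" by (rule rat_mat_inj)
  have "rat_mat (?B\<^sup>T * M\<^sup>T) = rat_mat (int (level Q) \<cdot>\<^sub>m ?A\<^sup>T)"
    using hm[of "?B\<^sup>T" "M\<^sup>T"] M mult_smult_distrib[OF WB(2) QT, of ?l] BQ
    by (simp add: rMT hs)
  then have BM: "?B\<^sup>T * M\<^sup>T = int (level Q) \<cdot>\<^sub>m ?A\<^sup>T" by (rule rat_mat_inj)
  have prim: "\<exists>i < n. \<exists>j < n. \<not> p dvd M $$ (i, j)" if p: "prime p" "p dvd int (level Q)" for p
  proof (rule ccontr)
    assume "\<not> ?thesis"
    then have pM: "p dvd M $$ (i, j)" if "i < n" "j < n" for i j using that by blast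
    define q where "q = nat p"
    have q: "int q = p" "q > 1" using prime_gt_1_int[OF p(1)] by (auto simp: q_def)
    then have "q dvd level Q" using p(2) by auto
    then obtain l where l: "level Q = q * l" by (rule dvdE)
    have "of_nat l * Q $$ (i, j) \<in> \<int>" if ij: "i < n" "j < n" for i j
    proof -
      obtain m where m: "M $$ (i, j) = int q * m" using pM[OF ij] q by auto
      have "rat_of_nat q * (of_nat l * Q $$ (i, j)) = rat_of_nat q * of_int m"
        using Mij[OF ij, symmetric] unfolding m by (simp add: l mult.assoc)
      then show ?thesis using q by simp
    qed
    then have "q * l dvd l" using level_dvd[OF Q(1), of l] l by simp
    moreover have "l > 0" using level_pos[OF Q(1)] l by (cases l) auto
    ultimately show False using q by (auto dest: dvd_imp_le)
  qed
  show ?thesis using that[OF M SM MM AM BM prim] .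
qed

section \<open>Coprimality of the levels of the two intertwiners\<close>

lemma walk_uminus:
  assumes T: "T \<in> carrier_mat n n"
  shows "walk n (- T) k = (-1) ^ k \<cdot>\<^sub>v walk n T k"
proof (induction k)
  case 0
  then show ?case using T by (simp add: walk_0)
next
  case (Suc k)
  have "walk n (- T) (Suc k) = - T *\<^sub>v ((-1) ^ k \<cdot>\<^sub>v walk n T k)"
    using T Suc by (simp add: walk_Suc)
  also have "\<dots> = (-1) ^ k \<cdot>\<^sub>v (- T *\<^sub>v walk n T k)"
    using T by (intro mult_mat_smult_vec[of _ n n]) auto
  also have "\<dots> = (-1) ^ k \<cdot>\<^sub>v - walk n T (Suc k)"
    using T by (simp add: walk_Suc)
  also have "\<dots> = (-1) ^ Suc k \<cdot>\<^sub>v walk n T (Suc k)" by (intro eq_vecI) auto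
  finally show ?case .
qed

lemma levels_coprime:
  assumes S: "S \<in> carrier_mat n n" and skS: "S\<^sup>T = - S"
    and T: "T \<in> carrier_mat n n"
    and det: "det (walk_mat n S) = 2 ^ (n div 2) * q" "odd q" "squarefree q"
    and detT: "(det (walk_mat n T))\<^sup>2 = (det (walk_mat n S))\<^sup>2"
    and Q: "reg_rat_orth n Q" "Q\<^sup>T * rat_mat S * Q = rat_mat T"
    and R: "reg_rat_orth n R" "R\<^sup>T * rat_mat S * R = rat_mat (- T)"
  shows "coprime (level Q) (level R)"
proof (rule ccontr)
  assume "\<not> ?thesis"
  then obtain r where r: "prime r" "r dvd level Q" "r dvd level R"
    by (metis coprime_iff_gcd_eq_1 gcd_greatest_iff prime_factor_nat)
  define p where "p = int r"
  have p: "prime p" "p dvd int (level Q)" "p dvd int (level R)" using r by (auto simp: p_def)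
  let ?A = "walk_mat n S" and ?B = "walk_mat n T"
  have mT: "- T \<in> carrier_mat n n" using T by simp
  obtain M where M: "M \<in> carrier_mat n n" "S * M = M * T"
    "M\<^sup>T * M = (int (level Q))\<^sup>2 \<cdot>\<^sub>m 1\<^sub>m n" "?A\<^sup>T * M = int (level Q) \<cdot>\<^sub>m ?B\<^sup>T"
    "?B\<^sup>T * M\<^sup>T = int (level Q) \<cdot>\<^sub>m ?A\<^sup>T"
    "\<exists>i < n. \<exists>j < n. \<not> p dvd M $$ (i, j)"
    using integral_intertwiner[OF Q(1) S T Q(2)] p by metis
  obtain N where N: "N \<in> carrier_mat n n" "S * N = N * - T"
    "?A\<^sup>T * N = int (level R) \<cdot>\<^sub>m (walk_mat n (- T))\<^sup>T"
    "(walk_mat n (- T))\<^sup>T * N\<^sup>T = int (level R) \<cdot>\<^sub>m ?A\<^sup>T"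
    "\<exists>i < n. \<exists>j < n. \<not> p dvd N $$ (i, j)"
    using integral_intertwiner[OF R(1) S mT R(2)] p by metis
  have coldvd: "dvd_vec p (X *\<^sub>v col Y j)"
    if "X \<in> carrier_mat n n" "Y \<in> carrier_mat n n" "j < n" "X * Y = l \<cdot>\<^sub>m Z" "p dvd l"
      "Z \<in> carrier_mat n n" for X Y Z :: "int mat" and j l
  proof -
    have "X *\<^sub>v col Y j = col (l \<cdot>\<^sub>m Z) j"
      using col_mult2[OF that(1,2,3)] that(4) by simp
    then show ?thesis using that(3,5,6) by (auto simp: dvd_vec_def)
  qed
  have Mc: "dvd_vec p (?A\<^sup>T *\<^sub>v col M j)" if "j < n" for j
    using coldvd[OF _ M(1) that M(4) p(2)] by simp
  have Mr: "dvd_vec p (?B\<^sup>T *\<^sub>v row M i)" if "i < n" for i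
    using coldvd[OF _ _ that M(5) p(2)] M(1) that by simp
  have Nc: "dvd_vec p (?A\<^sup>T *\<^sub>v col N j)" if "j < n" for j
    using coldvd[OF _ N(1) that N(3) p(3)] by simp
  \<comment> \<open>The walk matrices of \<open>T\<close> and \<open>- T\<close> differ by column
    signs, so their left kernels modulo \<open>p\<close> coincide.\<close>
  have Nr: "dvd_vec p (?B\<^sup>T *\<^sub>v row N i)" if i: "i < n" for i
  proof (rule dvd_vecI)
    fix k assume "k < dim_vec (?B\<^sup>T *\<^sub>v row N i)"
    then have k: "k < n" by simp
    have "dvd_vec p ((walk_mat n (- T))\<^sup>T *\<^sub>v row N i)"
      using coldvd[OF _ _ i N(4) p(3)] N(1) i by simp
    then have "p dvd walk n (- T) k \<bullet> row N i"
      using k mT by (auto simp: dvd_vec_def col_walk_mat)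
    also have "walk n (- T) k \<bullet> row N i = (-1) ^ k * (walk n T k \<bullet> row N i)"
      unfolding walk_uminus[OF T]
      using T N(1) i by (intro smult_scalar_prod_distrib[of _ n]) auto
    finally have "p dvd walk n T k \<bullet> row N i" by (cases "even k") auto
    then show "p dvd (?B\<^sup>T *\<^sub>v row N i) $ k" using k T by (simp add: col_walk_mat)
  qed
  have colM: "col M j \<bullet> col M j = (int (level Q))\<^sup>2" if "j < n" for j
  proof -
    have "col M j \<bullet> col M j = (M\<^sup>T * M) $$ (j, j)" using that M(1) by simp
    then show ?thesis unfolding M(3) using that by simp
  qed
  show False
  proof (cases "p = 2")
    case True
    have "dvd_vec 2 (col M j)" if j: "j < n" for j
    proof (rule even_of_walk_isotropic[OF S skS det(1,2)])
      show "col M j \<in> carrier_vec n" using M(1) j by simp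
      show "dvd_vec 2 (?A\<^sup>T *\<^sub>v col M j)" using Mc[OF j] True by simp
      fix k
      have pow: "S ^\<^sub>m k \<in> carrier_mat n n" "T ^\<^sub>m k \<in> carrier_mat n n" for k using S T by auto
      have SkM: "S ^\<^sub>m k * M = M * T ^\<^sub>m k"
      proof (induction k)
        case 0
        then show ?case using S T M(1) by simp
      next
        case (Suc k)
        have "S ^\<^sub>m Suc k * M = S ^\<^sub>m k * (M * T)"
          using assoc_mult_mat[OF pow(1) S M(1)] M(2) by simp
        also have "\<dots> = M * T ^\<^sub>m k * T"
          unfolding assoc_mult_mat[OF pow(1) M(1) T, symmetric] Suc ..
        also have "\<dots> = M * T ^\<^sub>m Suc k" using assoc_mult_mat[OF M(1) pow(2) T] by simp
        finally show ?case .
      qed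
      \<comment> \<open>The intertwining relation reduces these products to the square of the level
        times a power of \<open>T\<close>; as the level is even here, 4 divides them.\<close>
      have "col M j \<bullet> (S ^\<^sub>m k *\<^sub>v col M j) = (M\<^sup>T * (S ^\<^sub>m k * M)) $$ (j, j)"
        using col_mult2[OF pow(1) M(1) j] M(1) pow(1)[of k] j by simp
      also have "M\<^sup>T * (S ^\<^sub>m k * M) = M\<^sup>T * M * T ^\<^sub>m k"
        unfolding SkM using M(1) pow by (simp add: assoc_mult_mat[of _ n n _ n _ n] mult_carrier_mat[of _ n n _ n])
      also have "\<dots> = (int (level Q))\<^sup>2 \<cdot>\<^sub>m T ^\<^sub>m k"
        unfolding M(3) mult_smult_assoc_mat[OF one_carrier_mat pow(2)] left_mult_one_mat[OF pow(2)] ..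
      also have "\<dots> $$ (j, j) = (int (level Q))\<^sup>2 * (T ^\<^sub>m k) $$ (j, j)"
        using j T by simp
      finally have *: "col M j \<bullet> (S ^\<^sub>m k *\<^sub>v col M j) = (int (level Q))\<^sup>2 * (T ^\<^sub>m k) $$ (j, j)" .
      have "(2::int)\<^sup>2 dvd (int (level Q))\<^sup>2" using p(2) True by (intro dvd_power_same) simp
      then show "4 dvd col M j \<bullet> (S ^\<^sub>m k *\<^sub>v col M j)" unfolding * by (intro dvd_mult2) simp
    qed
    then show False using M(1,6) True by (auto simp: dvd_vec_def)
  next
    case False
    have p2: "\<not> p dvd 2" using prime_gt_1_int[OF p(1)] False zdvd_imp_le[of p 2] by auto
    have "coprime (p\<^sup>2) (2 ^ (n div 2))"
      using prime_imp_coprime[OF p(1) p2] by simp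
    moreover have "\<not> p\<^sup>2 dvd q" using det(3) p(1) by (meson squarefreeD not_prime_unit)
    ultimately have dS: "\<not> p\<^sup>2 dvd det ?A"
      unfolding det(1) by (simp add: coprime_dvd_mult_right_iff)
    have "det ?B = det ?A \<or> det ?B = - det ?A" using detT by (simp add: power2_eq_iff)
    then have dT: "\<not> p\<^sup>2 dvd det ?B" using dS by auto
    have iso: "p dvd col M j \<bullet> col M j" if "j < n" for j
      unfolding colM[OF that] using p(2) by (simp add: power2_eq_square)
    have SN: "S * N = - (N * T)" using N(1,2) T by simp
    from intertwiners_not_both_nonzero_mod[OF S skS T M(1) N(1) p(1) p2 dS dT Mc Mr Nc Nr iso M(2) SN]
    show False using M(6) N(5) by blast
  qed
qed

section \<open>Skew-adjacency matrices and the factorization of \<open>Q0\<close>\<close>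

lemma skew_adj_carrier [simp]: "skew_adj n A \<in> carrier_mat n n"
  by (simp add: skew_adj_def)

lemma skew_adj_transpose: "oriented_graph n A \<Longrightarrow> (skew_adj n A)\<^sup>T = - skew_adj n A"
  by (intro eq_matI) (auto simp: skew_adj_def oriented_graph_def)

lemma skew_adj_converse: "oriented_graph n A \<Longrightarrow> skew_adj n (A\<inverse>) = - skew_adj n A"
  by (intro eq_matI) (auto simp: skew_adj_def oriented_graph_def)

theorem theorem5p2:
  fixes n :: nat and A :: "(nat \<times> nat) set" and Q0 :: "rat mat"
  assumes "in_G n A"
    and "reg_rat_orth n Q0"
    and "transpose_mat Q0 * map_mat rat_of_int (skew_adj n A) * Q0
           = map_mat rat_of_int (skew_adj n (A\<inverse>))"
    and "\<not> factorable n Q0"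
  shows "WDGSS n A"
  unfolding WDGSS_def
proof (intro allI impI, elim conjE)
  fix B assume B: "oriented_graph n B" and cosp: "gen_cospectral n A B"
  define S where "S = skew_adj n A"
  define T where "T = skew_adj n B"
  have A: "oriented_graph n A" using assms(1) by (simp add: in_G_def)
  have S: "S \<in> carrier_mat n n" "S\<^sup>T = - S" using skew_adj_transpose[OF A] by (auto simp: S_def)
  have T: "T \<in> carrier_mat n n" "T\<^sup>T = - T" using skew_adj_transpose[OF B] by (auto simp: T_def)
  define q where "q = det (walk_mat n S) div 2 ^ (n div 2)"
  have det: "det (walk_mat n S) = 2 ^ (n div 2) * q" "odd q" "squarefree q"
    using assms(1) by (auto simp: in_G_def Let_def S_def q_def)
  have "walk_count n S k = walk_count n T k" for k
    using cosp walk_count_eq_of_char_poly_eq[OF S(1) T(1)]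
    by (simp add: gen_cospectral_def S_def T_def)
  moreover have "det (walk_mat n S) \<noteq> 0" using det by auto
  ultimately obtain Q where Q: "reg_rat_orth n Q" "Q\<^sup>T * rat_mat S * Q = rat_mat T"
    and detT: "(det (walk_mat n T))\<^sup>2 = (det (walk_mat n S))\<^sup>2"
    using exists_intertwiner[OF S T] by metis
  note Qc = reg_rat_orthD[OF Q(1)] and Q0c = reg_rat_orthD[OF assms(2)]
  define R where "R = Q0 * Q"
  have R: "reg_rat_orth n R" unfolding R_def by (rule reg_rat_orth_mult[OF assms(2) Q(1)])
  note Rc = reg_rat_orthD[OF R]
  have S': "rat_mat S \<in> carrier_mat n n" using S by simp
  have "R\<^sup>T * rat_mat S * R = Q\<^sup>T * (Q0\<^sup>T * rat_mat S * Q0) * Q"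
    using Qc(1) Q0c(1) S' by (simp add: R_def transpose_mult[of _ n n _ n] assoc_mult_mat[of _ n n _ n _ n] mult_carrier_mat[of _ n n _ n])
  also have "Q0\<^sup>T * rat_mat S * Q0 = - rat_mat S"
    using assms(3) skew_adj_converse[OF A] by (simp add: S_def) (intro eq_matI, auto)
  also have "Q\<^sup>T * - rat_mat S * Q = - (Q\<^sup>T * rat_mat S * Q)" using Qc(1) S' by simp
  also have "\<dots> = rat_mat (- T)" unfolding Q(2) by (intro eq_matI) auto
  finally have RT: "R\<^sup>T * rat_mat S * R = rat_mat (- T)" .
  have cop: "coprime (level Q) (level R)"
    by (rule levels_coprime[OF S T(1) det detT Q R RT])
  show "og_isomorphic n A B \<or> og_isomorphic n (A\<inverse>) B"
  proof (cases "is_perm_mat n Q \<or> is_perm_mat n R")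
    case True
    then show ?thesis
    proof
      assume "is_perm_mat n Q"
      then show ?thesis using og_isomorphic_of_rat Q(2) by (auto simp: S_def T_def)
    next
      assume perm: "is_perm_mat n R"
      \<comment> \<open>The converse has matrix \<open>- S\<close>, and \<open>R\<close> takes
        \<open>S\<close> to \<open>- T\<close>; the signs cancel.\<close>
      have "R\<^sup>T * rat_mat (skew_adj n (A\<inverse>)) * R = - (R\<^sup>T * rat_mat S * R)"
      proof -
        have "rat_mat (skew_adj n (A\<inverse>)) = - rat_mat S"
          unfolding skew_adj_converse[OF A] S_def by (intro eq_matI) auto
        then show ?thesis using Rc(1) S' by simp
      qed
      also have "\<dots> = rat_mat T" unfolding RT by (intro eq_matI) auto
      finally show ?thesis using og_isomorphic_of_rat[OF perm] by (simp add: T_def)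
    qed
  next
    case False
    have Q0QR: "Q0 = R * Q\<^sup>T"
      using Qc(1,3) Q0c(1) by (simp add: R_def assoc_mult_mat[of _ n n _ n _ n] mult_carrier_mat[of _ n n _ n])
    have QQ0R: "Q = Q0\<^sup>T * R"
    proof -
      have "Q0\<^sup>T * R = Q0\<^sup>T * Q0 * Q"
        using Qc(1) Q0c(1) by (simp add: R_def assoc_mult_mat[of _ n n _ n _ n] mult_carrier_mat[of _ n n _ n])
      then show ?thesis using Q0c(2) Qc(1) by simp
    qed
    have "level Q dvd level Q0 * level R"
      using level_mult_dvd[of "Q0\<^sup>T" n R] Q0c(1) Rc(1) QQ0R by (simp add: level_transpose[of _ n])
    then have QQ0: "level Q dvd level Q0" using cop by (simp add: coprime_dvd_mult_left_iff)
    have "level R dvd level Q0 * level Q"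
      using level_mult_dvd[OF Q0c(1) Qc(1)] by (simp add: R_def)
    then have RQ0: "level R dvd level Q0"
      using cop by (simp add: coprime_dvd_mult_left_iff coprime_commute)
    \<comment> \<open>Since neither level is 1, this bound makes each of them strictly smaller than
      the level of \<open>Q0\<close>.\<close>
    have prod: "level Q * level R \<le> level Q0"
      using divides_mult[OF QQ0 RQ0 cop] level_pos[OF Q0c(1)] by (rule dvd_imp_le)
    have "level Q \<noteq> 1" "level R \<noteq> 1"
      using False is_perm_mat_of_level_1 Q(1) R by blast+
    then have "1 < level Q" "1 < level R"
      using level_pos[OF Qc(1)] level_pos[OF Rc(1)] by linarith+
    then have less: "level Q < level Q0" "level R < level Q0"
      using less_le_trans[OF _ prod] n_less_m_mult_n[of "level R" "level Q"]
        n_less_m_mult_n[of "level Q" "level R"] by (simp_all add: mult.commute)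
    \<comment> \<open>The second factor is the transpose of \<open>Q\<close>; transposing a
      permutation matrix inverts its permutation.\<close>
    have "\<not> is_perm_mat n Q\<^sup>T"
    proof
      assume "is_perm_mat n Q\<^sup>T"
      then obtain \<pi> where \<pi>: "\<pi> permutes {0..<n}" "Q\<^sup>T = perm_mat n \<pi>" by (auto simp: is_perm_mat_def)
      have "(Q\<^sup>T)\<^sup>T = (perm_mat n \<pi>)\<^sup>T" using \<pi>(2) by simp
      also have "\<dots> = perm_mat n (Hilbert_Choice.inv \<pi>)"
        using permutes_inverses[OF \<pi>(1)] by (intro eq_matI) (auto simp: perm_mat_def)
      finally have "is_perm_mat n Q"
        using permutes_inv[OF \<pi>(1)] by (auto simp: is_perm_mat_def)
      then show False using False by blast
    qed
    then have "factorable n Q0"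
      unfolding factorable_def
      using R reg_rat_orth_transpose[OF Q(1)] less False Q0QR level_transpose[OF Qc(1)]
      by (intro exI[of _ R] exI[of _ "Q\<^sup>T"]) simp
    then show ?thesis using assms(4) by blast
  qed
qed

end
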